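(* Let $\mu_0,\mu_1$ be arbitrary Borel probability measures on $\mathbb{R}$ and let $(\mu_t)_{t\in[0,1]}$ be their monotone interpolation. For every $1\leq p<\infty$, the function $t\mapsto\mathsf{C}_p(\mu_t)^{1/p}$ is convex on $[0,1]$. In particular, \[ \mathsf{C}_p(\mu_t)^{1/p}\leq(1-t)\,\mathsf{C}_p(\mu_0)^{1/p}+t\,\mathsf{C}_p(\mu_1)^{1/p},\qquad t\in(0,1). \] For $p=2$ and $p=1$, this reads respectively \[ \sqrt{C_P(\mu_t)}\leq(1-t)\sqrt{C_P(\mu_0)}+t\sqrt{C_P(\mu_1)},\qquad t\in(0,1), \] and \[ \frac{1}{h(\mu_t)}\leq\frac{1-t}{h(\mu_0)}+\frac{t}{h(\mu_1)},\qquad t\in(0,1). \]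
   Context: For a probability measure $\mu$ on $\mathbb{R}$, its left-continuous quantile function is $Q_\mu(u)=\inf\{x\in\mathbb{R}:\mu((-\infty,x])\geq u\}$, $u\in(0,1)$. Let $\lambda$ be Lebesgue measure on $(0,1)$. The monotone interpolation between $\mu_0$ and $\mu_1$ is $\mu_t=(Q_t)_\#\lambda$ with $Q_t=(1-t)Q_{\mu_0}+tQ_{\mu_1}$, $t\in[0,1]$, where $T_\#\mu$ denotes the image of $\mu$ under $T$. For a Borel probability measure $\mu$ on $\mathbb{R}$ and $1\leq p<\infty$, $\mathsf{C}_p(\mu)\in[0,+\infty]$ is the best (smallest) constant $C$ in \[ \inf_{a\in\mathbb{R}}\int|f-a|^p\,\mathrm{d}\mu\leq C\int|f'|^p\,\mathrm{d}\mu \] for all $f\in C^1(\mathbb{R})$ with $f'\in C_c(\mathbb{R})$ (continuous with compact support); it is $+\infty$ if no finite constant works. $C_P(\mu)=\mathsf{C}_2(\mu)$ is the Poincaré constant, i.e. the best constant in $\int|f-\int f\,\mathrm{d}\mu|^2\,\mathrm{d}\mu\leq C\int|f'|^2\,\mathrm{d}\mu$ over the same test functions. The Cheeger isoperimetric constant is \[ h(\mu)=\inf_A\frac{\mu^+(A)}{\min\{\mu(A),1-\mu(A)\}}, \] the infimum over Borel sets $A$ with $0<\mu(A)<1$ (it is $+\infty$ if there is no such set), where $\mu^+(A)=\liminf_{r\to0^+}\frac{\mu(A^r)-\mu(A)}{r}$ and $A^r=\{x:\operatorname{dist}(x,A)<r\}$. Conventions: $1/0=+\infty$, $1/(+\infty)=0$.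 It is a known fact that $\mathsf{C}_1(\mu)=1/h(\mu)$. Convexity is understood for $[0,+\infty]$-valued functions. *)

theory Defs
  imports "HOL-Probability.Probability"
begin

text \<open>
  Borel probability measures on the real line are measures satisfying \<open>real_distribution\<close>.
  All constants take values in \<^typ>\<open>ennreal\<close>, where \<open>1 / 0 = \<infinity>\<close>, \<open>1 / \<infinity> = 0\<close> and \<open>Inf {} = \<infinity>\<close>.
\<close>

definition quantile :: "real measure \<Rightarrow> real \<Rightarrow> real" where
  "quantile \<mu> u = Inf {x. u \<le> cdf \<mu> x}"

definition monotone_interpolation :: "real measure \<Rightarrow> real measure \<Rightarrow> real \<Rightarrow> real measure" where
  "monotone_interpolation \<mu>0 \<mu>1 t =
     distr (restrict_space lborel {0<..<1}) borel
       (\<lambda>u. (1 - t) * quantile \<mu>0 u + t * quantile \<mu>1 u)"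

definition test_functions :: "(real \<Rightarrow> real) set" where
  "test_functions = {f. f C1_differentiable_on UNIV \<and> compact (closure {x. deriv f x \<noteq> 0})}"

text \<open>
  Admitting the value \<open>\<infinity>\<close> among the competing constants is harmless: the infimum is \<open>\<infinity>\<close>
  exactly when no finite constant is admissible.
\<close>

definition poincare_Lp_const :: "real \<Rightarrow> real measure \<Rightarrow> ennreal" where
  "poincare_Lp_const p \<mu> = Inf {C. \<forall>f\<in>test_functions.
     (INF a::real. \<integral>\<^sup>+ x. ennreal (\<bar>f x - a\<bar> powr p) \<partial>\<mu>)
       \<le> C * (\<integral>\<^sup>+ x. ennreal (\<bar>deriv f x\<bar> powr p) \<partial>\<mu>)}"

text \<open>
  Every test function is bounded, being constant outside a compact interval, so the mean
  \<open>\<integral>x. f x \<partial>\<mu>\<close> below is always a genuine Bochner integral.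
\<close>

definition poincare_const :: "real measure \<Rightarrow> ennreal" where
  "poincare_const \<mu> = Inf {C. \<forall>f\<in>test_functions.
     (\<integral>\<^sup>+ x. ennreal (\<bar>f x - (\<integral>y. f y \<partial>\<mu>)\<bar>\<^sup>2) \<partial>\<mu>)
       \<le> C * (\<integral>\<^sup>+ x. ennreal (\<bar>deriv f x\<bar>\<^sup>2) \<partial>\<mu>)}"

text \<open>
  \<^const>\<open>infdist\<close> to the empty set is \<open>0\<close>; the neighbourhood is only used for nonempty \<open>A\<close>.
\<close>

definition open_nbhd :: "real set \<Rightarrow> real \<Rightarrow> real set" where
  "open_nbhd A r = {x. infdist x A < r}"

definition boundary_measure :: "real measure \<Rightarrow> real set \<Rightarrow> ennreal" where
  "boundary_measure \<mu> A =
     Liminf (at_right 0) (\<lambda>r. ennreal ((measure \<mu> (open_nbhd A r) - measure \<mu> A) / r))"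

definition cheeger_const :: "real measure \<Rightarrow> ennreal" where
  "cheeger_const \<mu> =
     (INF A\<in>{A \<in> sets borel. 0 < measure \<mu> A \<and> measure \<mu> A < 1}.
        boundary_measure \<mu> A / ennreal (min (measure \<mu> A) (1 - measure \<mu> A)))"

text \<open>Powers with positive real exponent on \<open>[0, \<infinity>]\<close>.\<close>

definition ennreal_powr :: "ennreal \<Rightarrow> real \<Rightarrow> ennreal" where
  "ennreal_powr x a = (if x = \<infinity> then \<infinity> else ennreal (enn2real x powr a))"

text \<open>
  The counterpart of \<^const>\<open>convex_on\<close> for \<open>[0, \<infinity>]\<close>-valued functions, with \<open>0 * \<infinity> = 0\<close>.
\<close>

definition ennreal_convex_on :: "'a::real_vector set \<Rightarrow> ('a \<Rightarrow> ennreal) \<Rightarrow> bool" where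
  "ennreal_convex_on S f \<longleftrightarrow> convex S \<and>
     (\<forall>x\<in>S. \<forall>y\<in>S. \<forall>u\<ge>0. \<forall>v\<ge>0. u + v = 1 \<longrightarrow>
        f (u *\<^sub>R x + v *\<^sub>R y) \<le> ennreal u * f x + ennreal v * f y)"

end

theory Submission
  imports Defs
begin

text \<open>
  Let \<open>\<nu> = \<mu> t\<close> with \<open>0 < t < 1\<close>. Since \<open>Q0\<close> and \<open>Q1\<close> are nondecreasing, both are nondecreasing functions
  \<open>T0\<close>, \<open>T1\<close> of \<open>(1 - t) * Q0 + t * Q1\<close>, with \<open>(1 - t) * T0 + t * T1\<close> the identity; so \<open>\<mu>0\<close> and \<open>\<mu>1\<close> are the images
  of \<open>\<nu>\<close> under \<open>T0\<close> and \<open>T1\<close>. For a test function \<open>f\<close> one gets, up to a constant, \<open>f = (1 - t) * G0 + t * G1\<close>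
  where \<open>Gi\<close> is the Stieltjes primitive of \<open>f'\<close> with respect to \<open>Ti\<close>. As \<open>Gi\<close> factors through \<open>Ti\<close>, the
  inequality for \<open>\<mu>i\<close> bounds the distance of \<open>Gi\<close> to the constants in \<open>L\<^sup>p(\<nu>)\<close> by \<open>C\<^sub>p(\<mu>i)\<close> to the power
  \<open>1/p\<close> times the norm of \<open>f'\<close> in \<open>L\<^sup>p(\<nu>)\<close>, and the claim follows from the triangle inequality. For
  \<open>p = 1\<close>, the coarea inequality and smoothed indicator functions identify the constant with \<open>1 / h\<close>.
\<close>

section \<open>Test functions and primitives\<close>

text \<open>The obstacle is regularity. \<open>Gi\<close> is the primitive of some \<psi>, evaluated
  at \<open>Ti\<close>, where \<psi> is f' composed with a generalised inverse of \<open>Ti\<close>.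
  That inverse jumps at a value taken by \<open>Ti\<close> on a flat piece, e.g. where one quantile
  function is constant while the other moves. Such a value may be an atom of the image measure, so
  \<psi> may be discontinuous on a set of positive mass. Its full energy would be useless: the atom
  carries the mass of a whole interval under \<nu>, and |f'|^p at one point of that interval is not
  controlled by the integral of |f'|^p over it. The remedy is that a countable set is Lebesgue null:
  continuous approximants can be forced to vanish there, which removes these points from the energy
  and leaves the primitive unchanged in the limit. Off them the generalised inverse really inverts
  \<open>Ti\<close> on the support of f'. The triangle inequality is obtained from convexity of the
  p-th power with weights proportional to the two constants, which loses nothing. Infima that may
  not be attained are handled by strict inequalities between constants and an additive
  \<epsilon>.\<close>

lemma powr_convex_combination:
  fixes u v p \<theta> :: real
  assumes p: "p \<ge> 1" and "0 \<le> u" "0 \<le> v" "0 \<le> \<theta>" "\<theta> \<le> 1"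
  shows "(\<theta> * u + (1 - \<theta>) * v) powr p \<le> \<theta> * u powr p + (1 - \<theta>) * v powr p"
proof -
  \<comment> \<open>Covers the degenerate case where u or v is 0: there convexity reduces to s^p
    \<le> s on [0, 1].\<close>
  have scale: "(s * w) powr p \<le> s * w powr p" if "0 \<le> s" "s \<le> 1" "0 \<le> w" for s w :: real
  proof -
    have "s powr p \<le> s" using that p powr_mono'[of 1 p s] by (cases "s = 0") auto
    then have "s powr p * w powr p \<le> s * w powr p" by (intro mult_right_mono) auto
    then show ?thesis using that by (simp add: powr_mult)
  qed
  show ?thesis
  proof (cases "u = 0 \<or> v = 0")
    case True
    then show ?thesis using scale[of \<theta> u] scale[of "1-\<theta>" v] assms by auto
  next
    case False
    then show ?thesis
      using convex_onD[OF powr_convex[OF p], of "1-\<theta>" u v] assms by auto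
  qed
qed

text \<open>Convexity at the points |x| / \<theta> and |y| / (1 - \<theta>). For \<theta> close to 1
  the coefficient of the first term is close to 1, so a small perturbation y can be absorbed at an
  arbitrarily small relative cost.\<close>

lemma powr_abs_add_le:
  fixes x y p \<theta> :: real
  assumes p: "p \<ge> 1" and \<theta>: "0 < \<theta>" "\<theta> < 1"
  shows "\<bar>x + y\<bar> powr p \<le> \<theta> powr (1 - p) * \<bar>x\<bar> powr p + (1 - \<theta>) powr (1 - p) * \<bar>y\<bar> powr p"
proof -
  have "\<bar>x + y\<bar> powr p \<le> (\<theta> * (\<bar>x\<bar> / \<theta>) + (1 - \<theta>) * (\<bar>y\<bar> / (1 - \<theta>))) powr p"
    using \<theta> p by (intro powr_mono2) auto
  also have "\<dots> \<le> \<theta> * (\<bar>x\<bar> / \<theta>) powr p + (1 - \<theta>) * (\<bar>y\<bar> / (1 - \<theta>)) powr p"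
    using \<theta> by (intro powr_convex_combination p) auto
  also have "\<dots> = \<theta> powr (1 - p) * \<bar>x\<bar> powr p + (1 - \<theta>) powr (1 - p) * \<bar>y\<bar> powr p"
    using \<theta> by (simp add: powr_divide powr_diff)
  finally show ?thesis .
qed

definition primitive :: "(real \<Rightarrow> real) \<Rightarrow> real \<Rightarrow> real" where
  "primitive \<psi> y = (\<integral>x. indicator {..y} x * \<psi> x \<partial>lborel)"

lemma integrable_bounded_support:
  fixes \<psi> :: "real \<Rightarrow> real"
  assumes "\<psi> \<in> borel_measurable borel" "\<And>x. \<bar>\<psi> x\<bar> \<le> B" "\<And>x. x \<notin> {-L..L} \<Longrightarrow> \<psi> x = 0"
  shows "integrable lborel \<psi>"
proof (rule Bochner_Integration.integrable_bound)
  show "integrable lborel (\<lambda>x. indicator {-L..L} x * B)"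
    by (intro integrable_mult_left) (auto simp: integrable_indicator_iff emeasure_lborel_Icc_eq)
  show "\<psi> \<in> borel_measurable lborel" using assms by simp
  have "norm (\<psi> x) \<le> norm (indicator {- L..L} x * B)" for x
    using assms(2)[of x] assms(3)[of x] by (auto simp: indicator_def)
  then show "AE x in lborel. norm (\<psi> x) \<le> norm (indicator {- L..L} x * B)" by simp
qed

text \<open>One estimate for several uses: c = \<psi> x gives differentiability, c = 0 the Lipschitz
  bound, and e = 0 the exact increment where \<psi> is constant. Values at the endpoints are left
  free, since they do not affect the integral.\<close>

lemma primitive_increment:
  assumes int: "integrable lborel \<psi>" and ab: "a \<le> b"
    and bound: "\<And>x. a < x \<Longrightarrow> x < b \<Longrightarrow> \<bar>\<psi> x - c\<bar> \<le> e"
  shows "\<bar>primitive \<psi> b - primitive \<psi> a - c * (b - a)\<bar> \<le> e * (b - a)"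
proof -
  have i: "integrable lborel (\<lambda>x. indicator A x * \<psi> x)" if "A \<in> sets borel" for A
    using integrable_mult_indicator[OF _ int, of A] that by simp
  have "primitive \<psi> b - primitive \<psi> a = (\<integral>x. indicator {..b} x * \<psi> x - indicator {..a} x * \<psi> x \<partial>lborel)"
    unfolding primitive_def by (rule Bochner_Integration.integral_diff[symmetric]; rule i) auto
  also have "\<dots> = (\<integral>x. indicator {a<..b} x * \<psi> x \<partial>lborel)"
    using ab by (intro Bochner_Integration.integral_cong) (auto simp: indicator_def)
  finally have 1: "primitive \<psi> b - primitive \<psi> a = (\<integral>x. indicator {a<..b} x * \<psi> x \<partial>lborel)" .
  have "(\<integral>x. indicator {a<..b} x * \<psi> x \<partial>lborel) - c * (b - a)
      = (\<integral>x. indicator {a<..b} x * \<psi> x - indicator {a<..b} x * c \<partial>lborel)"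
    using ab by (subst Bochner_Integration.integral_diff[OF i]) auto
  also have "\<bar>\<dots>\<bar> \<le> (\<integral>x. \<bar>indicator {a<..b} x * \<psi> x - indicator {a<..b} x * c\<bar> \<partial>lborel)"
    by (rule integral_abs_bound)
  also have "\<dots> \<le> (\<integral>x. indicator {a<..b} x * e \<partial>lborel)"
  proof (rule integral_mono_AE)
    show "integrable lborel (\<lambda>x. \<bar>indicator {a<..b} x * \<psi> x - indicator {a<..b} x * c\<bar>)"
      using ab by (intro integrable_abs Bochner_Integration.integrable_diff i) auto
    show "integrable lborel (\<lambda>x. indicator {a<..b} x * e)" using ab by simp
    have "AE x in lborel. x \<noteq> b" by (rule AE_lborel_singleton)
    then show "AE x in lborel. \<bar>indicator {a<..b} x * \<psi> x - indicator {a<..b} x * c\<bar> \<le> indicator {a<..b} x * e"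
    proof eventually_elim
      case (elim x)
      then show ?case using bound[of x] by (cases "x \<in> {a<..b}") auto
    qed
  qed
  also have "\<dots> = e * (b - a)" using ab by simp
  finally show ?thesis using 1 by simp
qed

lemma primitive_diff_le:
  assumes "integrable lborel \<psi>" "integrable lborel \<phi>"
  shows "\<bar>primitive \<psi> y - primitive \<phi> y\<bar> \<le> (\<integral>x. \<bar>\<psi> x - \<phi> x\<bar> \<partial>lborel)"
proof -
  have i: "integrable lborel (\<lambda>x. indicator {..y} x * f x)" if "integrable lborel f" for f :: "real \<Rightarrow> real"
    using integrable_mult_indicator[OF _ that, of "{..y}"] by simp
  have "primitive \<psi> y - primitive \<phi> y = (\<integral>x. indicator {..y} x * \<psi> x - indicator {..y} x * \<phi> x \<partial>lborel)"
    unfolding primitive_def by (rule Bochner_Integration.integral_diff[symmetric]; rule i[OF assms(1)] i[OF assms(2)])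
  also have "\<bar>\<dots>\<bar> \<le> (\<integral>x. \<bar>indicator {..y} x * \<psi> x - indicator {..y} x * \<phi> x\<bar> \<partial>lborel)"
    by (rule integral_abs_bound)
  also have "\<dots> \<le> (\<integral>x. \<bar>\<psi> x - \<phi> x\<bar> \<partial>lborel)"
    using assms i by (intro integral_mono) (auto simp: indicator_def)
  finally show ?thesis .
qed

text \<open>Near x continuity makes \<phi> e-close to c = \<phi> x, and the hypothesis then bounds
  the difference quotient. Arbitrary slopes c on arbitrary intervals are allowed in it because this
  form carries over to Stieltjes primitives, with increments of T in place of b - a, and adds up
  over convex combinations.\<close>

lemma DERIV_from_increments:
  fixes G \<phi> :: "real \<Rightarrow> real"
  assumes cont: "isCont \<phi> x"
    and incr: "\<And>a b c e. a \<le> b \<Longrightarrow> (\<And>z. a \<le> z \<Longrightarrow> z \<le> b \<Longrightarrow> \<bar>\<phi> z - c\<bar> \<le> e)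
                 \<Longrightarrow> \<bar>G b - G a - c * (b - a)\<bar> \<le> e * (b - a)"
  shows "(G has_real_derivative \<phi> x) (at x)"
  unfolding has_field_derivative_def has_derivative_within_alt
proof (intro conjI allI impI)
  show "bounded_linear ((*) (\<phi> x))" by (rule bounded_linear_mult_right)
  fix e :: real assume "e > 0"
  then obtain d where d: "d > 0" "\<And>z. \<bar>z - x\<bar> < d \<Longrightarrow> \<bar>\<phi> z - \<phi> x\<bar> < e"
    using cont unfolding continuous_at_eps_delta by (auto simp: dist_real_def)
  have "\<bar>G y - G x - \<phi> x * (y - x)\<bar> \<le> e * \<bar>y - x\<bar>" if "\<bar>y - x\<bar> < d" for y
  proof (cases "x \<le> y")
    case True
    have "\<bar>G y - G x - \<phi> x * (y - x)\<bar> \<le> e * (y - x)"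
      using True that by (intro incr less_imp_le[OF d(2)]) auto
    then show ?thesis using True by simp
  next
    case False
    have "\<bar>G x - G y - \<phi> x * (x - y)\<bar> \<le> e * (x - y)"
      using False that by (intro incr less_imp_le[OF d(2)]) auto
    moreover have "\<bar>G y - G x - \<phi> x * (y - x)\<bar> = \<bar>G x - G y - \<phi> x * (x - y)\<bar>"
      by (subst abs_minus_cancel[symmetric]) (simp add: algebra_simps)
    ultimately show ?thesis using False by simp
  qed
  then show "\<exists>d>0. \<forall>y\<in>UNIV. norm (y - x) < d \<longrightarrow> norm (G y - G x - \<phi> x * (y - x)) \<le> e * norm (y - x)"
    using d(1) by auto
qed

lemma test_functionI:
  assumes D: "\<And>x. (f has_real_derivative \<phi> x) (at x)"
    and cont: "continuous_on UNIV \<phi>" and supp: "\<And>x. x \<notin> {-L..L} \<Longrightarrow> \<phi> x = 0"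
  shows "f \<in> test_functions" "deriv f = \<phi>"
proof -
  show 1: "deriv f = \<phi>" using D by (auto intro: DERIV_imp_deriv)
  have "{x. \<phi> x \<noteq> 0} \<subseteq> {-L..L}" using supp by blast
  then have "closure {x. \<phi> x \<noteq> 0} \<subseteq> {-L..L}" by (rule closure_minimal) simp
  then have "compact (closure {x. \<phi> x \<noteq> 0})"
    using compact_Int_closed[OF compact_Icc closed_closure, of "-L" L "{x. \<phi> x \<noteq> 0}"]
    by (simp add: inf.absorb2)
  moreover have "f C1_differentiable_on UNIV"
    unfolding C1_differentiable_on_def
    using D cont by (auto simp: has_real_derivative_iff_has_vector_derivative)
  ultimately show "f \<in> test_functions"
    using 1 by (simp add: test_functions_def)
qed

lemma primitive_test_function:
  assumes cont: "continuous_on UNIV \<phi>" and supp: "\<And>x. x \<notin> {-L..L} \<Longrightarrow> \<phi> x = 0"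
  shows "primitive \<phi> \<in> test_functions" "deriv (primitive \<phi>) = \<phi>"
proof -
  have "compact (\<phi> ` {-L..L})"
    by (intro compact_continuous_image continuous_on_subset[OF cont]) auto
  then obtain B where B: "\<And>x. x \<in> {-L..L} \<Longrightarrow> \<bar>\<phi> x\<bar> \<le> B"
    by (metis (mono_tags, lifting) bounded_iff compact_imp_bounded imageI real_norm_def)
  have "integrable lborel \<phi>"
  proof (rule integrable_bounded_support)
    show "\<phi> \<in> borel_measurable borel" by (rule borel_measurable_continuous_onI[OF cont])
    show "\<bar>\<phi> x\<bar> \<le> max B 0" for x using B[of x] supp[of x] by (cases "x \<in> {-L..L}") auto
  qed (rule supp)
  then have D: "(primitive \<phi> has_real_derivative \<phi> x) (at x)" for x
    using cont by (intro DERIV_from_increments primitive_increment) (auto simp: continuous_on_eq_continuous_at)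
  from test_functionI[OF this cont supp]
  show "primitive \<phi> \<in> test_functions" "deriv (primitive \<phi>) = \<phi>" by auto
qed

lemma test_functionE:
  assumes "f \<in> test_functions"
  obtains L where "L > 0" "\<And>x. x \<notin> {-L..L} \<Longrightarrow> deriv f x = 0" "continuous_on UNIV (deriv f)"
    "\<And>x. (f has_real_derivative deriv f x) (at x)"
proof -
  obtain D where D: "\<And>x. (f has_vector_derivative D x) (at x)" "continuous_on UNIV D"
    using assms by (auto simp: test_functions_def C1_differentiable_on_def)
  have D': "(f has_real_derivative D x) (at x)" for x
    using D(1) by (simp add: has_real_derivative_iff_has_vector_derivative)
  then have [simp]: "deriv f = D" by (auto intro: DERIV_imp_deriv)
  have "bounded (closure {x. D x \<noteq> 0})"
    using assms by (auto simp: test_functions_def intro: compact_imp_bounded)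
  then obtain L where L: "L > 0" "\<And>x. x \<in> closure {x. D x \<noteq> 0} \<Longrightarrow> \<bar>x\<bar> \<le> L"
    unfolding bounded_pos by auto
  have "D x = 0" if "x \<notin> {-L..L}" for x
    using L(2)[of x] that closure_subset[of "{x. D x \<noteq> 0}"] by (auto simp: abs_le_iff)
  then show ?thesis using that[of L] L(1) D(2) D' by auto
qed

lemma test_function_bounded:
  assumes "f \<in> test_functions"
  obtains B where "\<And>x. \<bar>f x\<bar> \<le> B" "\<And>x. \<bar>deriv f x\<bar> \<le> B"
proof -
  obtain L where L: "L > 0" "\<And>x. x \<notin> {-L..L} \<Longrightarrow> deriv f x = 0"
    and cont: "continuous_on UNIV (deriv f)" and D: "\<And>x. (f has_real_derivative deriv f x) (at x)"
    using test_functionE[OF assms] by metis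
  have contf: "continuous_on UNIV f"
    using D by (meson DERIV_isCont continuous_at_imp_continuous_on)
  have "bounded ((\<lambda>x. \<bar>f x\<bar> + \<bar>deriv f x\<bar>) ` {-L..L})"
    by (intro compact_imp_bounded compact_continuous_image continuous_intros
        continuous_on_subset[OF cont] continuous_on_subset[OF contf]) auto
  then obtain B where B: "\<And>x. x \<in> {-L..L} \<Longrightarrow> \<bar>f x\<bar> + \<bar>deriv f x\<bar> \<le> B"
    by (metis (mono_tags, lifting) abs_of_nonneg abs_ge_zero add_nonneg_nonneg bounded_iff imageI real_norm_def)
  have B0: "0 \<le> B" using B[of 0] L(1) by auto
  have D0: "(f has_real_derivative 0) (at x)" if "x \<notin> {-L..L}" for x
    using D[of x] L(2)[OF that] by simp
  have right: "f x = f L" if "x > L" for x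
    using that by (intro DERIV_isconst2[OF that, of f] continuous_on_subset[OF contf])
      (simp_all add: D0)
  have left: "f x = f (-L)" if "x < -L" for x
    using that by (intro DERIV_isconst2[OF that, of f, symmetric] continuous_on_subset[OF contf])
      (simp_all add: D0)
  have "\<bar>f x\<bar> \<le> B" for x
  proof -
    consider "x < -L" | "x > L" | "x \<in> {-L..L}" unfolding atLeastAtMost_iff by linarith
    moreover have "\<bar>f L\<bar> \<le> B" "\<bar>f (-L)\<bar> \<le> B"
      using B[of L] B[of "-L"] L(1) by auto
    moreover have "\<bar>f x\<bar> \<le> B" if "x \<in> {-L..L}" using B[OF that] by linarith
    ultimately show ?thesis using right[of x] left[of x] by cases metis+
  qed
  moreover have "\<bar>deriv f x\<bar> \<le> B" for x
  proof (cases "x \<in> {-L..L}")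
    case True then show ?thesis using B[OF True] by linarith
  qed (use L(2) B0 in simp)
  ultimately show ?thesis using that by blast
qed

lemma test_function_measurable:
  assumes "f \<in> test_functions"
  shows "f \<in> borel_measurable borel" "deriv f \<in> borel_measurable borel"
proof -
  have cont: "continuous_on UNIV (deriv f)" and D: "\<And>x. (f has_real_derivative deriv f x) (at x)"
    using test_functionE[OF assms] by metis+
  show "deriv f \<in> borel_measurable borel" by (rule borel_measurable_continuous_onI[OF cont])
  show "f \<in> borel_measurable borel"
    by (intro borel_measurable_continuous_onI continuous_at_imp_continuous_on ballI DERIV_isCont[OF D])
qed

section \<open>Extension to primitives of discontinuous functions\<close>

text \<open>Real-valued form of the inequality behind \<open>poincare_Lp_const\<close>. The slack
  \<epsilon> stands for the infimum over a, so no minimiser has to be produced.\<close>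

definition Lp_admissible :: "real \<Rightarrow> real measure \<Rightarrow> real \<Rightarrow> bool" where
  "Lp_admissible p \<mu> C \<longleftrightarrow> (\<forall>f\<in>test_functions. \<forall>\<epsilon>>0. \<exists>a.
     (\<integral>x. \<bar>f x - a\<bar> powr p \<partial>\<mu>) \<le> C * (\<integral>x. \<bar>deriv f x\<bar> powr p \<partial>\<mu>) + \<epsilon>)"

lemma (in real_distribution) integrable_powr_bounded:
  fixes g :: "real \<Rightarrow> real"
  assumes "g \<in> borel_measurable borel" "\<And>x. \<bar>g x\<bar> \<le> B" "p \<ge> 0"
  shows "integrable M (\<lambda>x. \<bar>g x\<bar> powr p)"
  by (rule integrable_const_bound[of _ "B powr p"])
    (use assms in \<open>auto intro!: powr_mono2 AE_I2\<close>)

lemma isCont_primitive: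
  assumes "integrable lborel \<psi>" "\<And>x. \<bar>\<psi> x\<bar> \<le> B"
  shows "isCont (primitive \<psi>) x"
proof -
  have B: "0 \<le> B" using assms(2)[of 0] by linarith
  have *: "\<bar>primitive \<psi> b - primitive \<psi> a\<bar> \<le> B * (b - a)" if "a \<le> b" for a b
    using primitive_increment[OF assms(1) that, of 0 B] assms(2) by simp
  have "B-lipschitz_on UNIV (primitive \<psi>)"
  proof (intro lipschitz_onI B)
    fix a b show "dist (primitive \<psi> a) (primitive \<psi> b) \<le> B * dist a b"
      using *[of a b] *[of b a] by (cases "a \<le> b") (auto simp: dist_real_def abs_minus_commute)
  qed
  then have "continuous_on UNIV (primitive \<psi>)" by (rule lipschitz_on_continuous_on)
  then show ?thesis by (simp add: continuous_on_eq_continuous_at)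
qed

text \<open>A union bound: a product of cutoffs differs from 1 only where one of its factors
  does.\<close>

lemma one_minus_prod_le_sum:
  fixes c :: "'a \<Rightarrow> real"
  assumes "finite J" "\<And>j. j \<in> J \<Longrightarrow> 0 \<le> c j" "\<And>j. j \<in> J \<Longrightarrow> c j \<le> 1"
  shows "1 - (\<Prod>j\<in>J. c j) \<le> (\<Sum>j\<in>J. 1 - c j)"
  using assms
proof (induction J rule: finite_induct)
  case (insert i J)
  have "0 \<le> (\<Prod>j\<in>J. c j)" "(\<Prod>j\<in>J. c j) \<le> 1"
    using insert.prems by (auto intro!: prod_nonneg prod_le_1)
  then have "0 \<le> (1 - c i) * (1 - (\<Prod>j\<in>J. c j))"
    using insert.prems by (intro mult_nonneg_nonneg) auto
  then show ?case using insert by (auto simp: algebra_simps)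
qed simp

lemma moving_average_tendsto:
  assumes "integrable lborel \<psi>" "isCont \<psi> y"
  shows "(\<lambda>n. real (Suc n) * (primitive \<psi> (y + inverse (real (Suc n))) - primitive \<psi> y)) \<longlonglongrightarrow> \<psi> y"
proof -
  have "(primitive \<psi> has_real_derivative \<psi> y) (at y)"
    by (intro DERIV_from_increments assms(2) primitive_increment assms(1)) auto
  then have "(\<lambda>h. (primitive \<psi> (y + h) - primitive \<psi> y) / h) \<midarrow>0\<rightarrow> \<psi> y"
    by (simp add: DERIV_def)
  moreover have "filterlim (\<lambda>n. inverse (real (Suc n))) (at 0) sequentially"
    using LIMSEQ_inverse_real_of_nat by (intro filterlim_atI) auto
  ultimately have "(\<lambda>n. (primitive \<psi> (y + inverse (real (Suc n))) - primitive \<psi> y) / inverse (real (Suc n))) \<longlonglongrightarrow> \<psi> y"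
    by (rule filterlim_compose)
  then show ?thesis by (simp add: field_simps)
qed

text \<open>
  Approximants of \<open>\<psi>\<close> that vanish at more and more points of \<open>D\<close>: the points of \<open>D\<close> may be atoms
  of \<open>M\<close>, but the values of \<open>\<psi>\<close> there do not affect the primitive.
\<close>

lemma (in real_distribution) continuous_approximants:
  fixes \<psi> :: "real \<Rightarrow> real"
  assumes p: "p \<ge> 1" and meas: "\<psi> \<in> borel_measurable borel"
    and B: "\<And>x. \<bar>\<psi> x\<bar> \<le> B" and supp: "\<And>x. x \<notin> {-L..L} \<Longrightarrow> \<psi> x = 0"
    and D: "countable D" "\<And>y. y \<notin> D \<Longrightarrow> isCont \<psi> y"
    and J: "(\<integral>x. indicator (- D) x * \<bar>\<psi> x\<bar> powr p \<partial>M) < J" and \<eta>: "0 < \<eta>"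
  obtains g where "continuous_on UNIV g" "\<And>x. x \<notin> {-(L+1)..L+1} \<Longrightarrow> g x = 0"
    "\<And>x. \<bar>primitive g x - primitive \<psi> x\<bar> \<le> \<eta>" "(\<integral>x. \<bar>g x\<bar> powr p \<partial>M) \<le> J"
proof -
  \<comment> \<open>An inclusion rather than an equality, which admits an empty D. Surplus points of
    \<open>range d\<close> only lower the limit of the energies.\<close>
  obtain d :: "nat \<Rightarrow> real" where d: "D \<subseteq> range d"
    using countable_as_injective_image[of D] D(1)
    by (metis countable_insert insert_not_empty range_from_nat_into subset_insertI)
  define N where "N n = real (Suc n)" for n
  define f where "f = primitive \<psi>"
  \<comment> \<open>\<open>a n\<close> averages \<psi> over an interval of length 1 / N n.
    \<open>c n\<close> vanishes at the first n points of d and is 1 outside n intervals of radius 1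
    / (N n)^2. Their total length is at most 2 / N n, so the growing number of cutoffs still
    disappears in L^1 of Lebesgue measure.\<close>
  define a where "a n y = N n * (f (y + inverse (N n)) - f y)" for n y
  define c where "c n y = (\<Prod>j<n. min 1 ((N n)\<^sup>2 * \<bar>y - d j\<bar>))" for n y
  define g where "g n y = c n y * a n y" for n y
  have N: "N n > 0" "N n \<ge> 1" for n by (auto simp: N_def)
  have B0: "0 \<le> B" using B[of 0] by linarith
  have int: "integrable lborel \<psi>" by (rule integrable_bounded_support[OF meas B supp])
  have isf: "isCont f y" for y unfolding f_def by (rule isCont_primitive[OF int B])
  have contf: "continuous_on S f" for S using isf by (simp add: continuous_at_imp_continuous_on)
  have conta: "continuous_on UNIV (a n)" for n
    unfolding a_def by (intro continuous_intros continuous_on_compose2[OF contf[of UNIV]]) auto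
  have contc: "continuous_on UNIV (c n)" for n
    unfolding c_def by (intro continuous_intros)
  have contg: "continuous_on UNIV (g n)" for n
    unfolding g_def by (intro continuous_intros conta contc)
  have [measurable]: "a n \<in> borel_measurable borel" "c n \<in> borel_measurable borel" "g n \<in> borel_measurable borel" for n
    by (auto intro: borel_measurable_continuous_onI conta contc contg)
  note [measurable] = meas
  have aB: "\<bar>a n y\<bar> \<le> B" for n y
  proof -
    have "\<bar>f (y + inverse (N n)) - f y\<bar> \<le> B * inverse (N n)"
      using primitive_increment[OF int, of y "y + inverse (N n)" 0 B] B N[of n] by (simp add: f_def)
    then have "N n * \<bar>f (y + inverse (N n)) - f y\<bar> \<le> N n * (B * inverse (N n))"
      using N(1)[of n] by (rule mult_left_mono[OF _ less_imp_le])
    also have "\<dots> = B" using N(1)[of n] by simp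
    finally show ?thesis using N(1)[of n] by (simp add: a_def abs_mult)
  qed
  have a0: "a n y = 0" if "y \<notin> {-(L+1)..L+1}" for n y
  proof -
    have "inverse (N n) \<le> 1" using N[of n] by (simp add: inverse_le_1_iff)
    then have "\<bar>f (y + inverse (N n)) - f y\<bar> \<le> 0"
      using primitive_increment[OF int, of y "y + inverse (N n)" 0 0] that supp N[of n]
      by (fastforce simp: f_def)
    then show ?thesis by (simp add: a_def)
  qed
  have c01: "0 \<le> c n y" "c n y \<le> 1" for n y
    unfolding c_def by (auto intro!: prod_nonneg prod_le_1)
  have c_lower: "1 - c n y \<le> (\<Sum>j<n. indicator {d j - inverse ((N n)\<^sup>2)..d j + inverse ((N n)\<^sup>2)} y)" for n y
  proof -
    have "1 - c n y \<le> (\<Sum>j<n. 1 - min 1 ((N n)\<^sup>2 * \<bar>y - d j\<bar>))"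
      unfolding c_def by (intro one_minus_prod_le_sum) auto
    also have "\<dots> \<le> (\<Sum>j<n. indicator {d j - inverse ((N n)\<^sup>2)..d j + inverse ((N n)\<^sup>2)} y)"
    proof (intro sum_mono)
      fix j
      show "1 - min 1 ((N n)\<^sup>2 * \<bar>y - d j\<bar>) \<le> indicator {d j - inverse ((N n)\<^sup>2)..d j + inverse ((N n)\<^sup>2)} y"
      proof (cases "\<bar>y - d j\<bar> \<le> inverse ((N n)\<^sup>2)")
        case True
        then show ?thesis using N[of n] by (auto simp: indicator_def abs_le_iff)
      next
        case False
        then have "(N n)\<^sup>2 * \<bar>y - d j\<bar> \<ge> 1"
          using N[of n] by (simp add: field_simps)
        then show ?thesis by simp
      qed
    qed
    finally show ?thesis .
  qed
  have gabs: "\<bar>g n y\<bar> \<le> \<bar>a n y\<bar>" for n y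
    using c01[of n y] mult_right_mono[of "c n y" 1 "\<bar>a n y\<bar>"] by (simp add: g_def abs_mult)
  have g0: "g n y = 0" if "y \<notin> {-(L+1)..L+1}" for n y
    using a0[OF that] by (simp add: g_def)
  have gB: "\<bar>g n y\<bar> \<le> B" for n y using gabs[of n y] aB[of n y] by linarith
  have inta: "integrable lborel (a n)" for n by (rule integrable_bounded_support[OF _ aB a0]) auto
  have intg: "integrable lborel (g n)" for n by (rule integrable_bounded_support[OF _ gB g0]) auto
  have atend: "(\<lambda>n. a n y) \<longlonglongrightarrow> \<psi> y" if "y \<notin> D" for y
    using moving_average_tendsto[OF int D(2)[OF that]] by (simp add: a_def f_def N_def)
  have "(\<lambda>n. \<integral>y. \<bar>a n y - \<psi> y\<bar> \<partial>lborel) \<longlonglongrightarrow> (\<integral>y. 0 \<partial>(lborel :: real measure))"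
  proof (rule integral_dominated_convergence[where w = "\<lambda>y. indicator {-(L+1)..L+1} y * (2 * B)"])
    show "integrable lborel (\<lambda>y. indicator {-(L+1)..L+1} y * (2 * B))"
      by (intro integrable_mult_left) (auto simp: integrable_indicator_iff emeasure_lborel_Icc_eq)
    have "AE y in lborel. y \<notin> D"
      using countable_imp_null_set_lborel[OF D(1)] by (rule AE_not_in)
    then show "AE y in lborel. (\<lambda>n. \<bar>a n y - \<psi> y\<bar>) \<longlonglongrightarrow> 0"
    proof eventually_elim
      case (elim y)
      then show ?case using tendsto_rabs[OF tendsto_diff[OF atend[OF elim] tendsto_const[of "\<psi> y"]]] by simp
    qed
    have "norm \<bar>a n y - \<psi> y\<bar> \<le> indicator {-(L+1)..L+1} y * (2 * B)" for n y
      using aB[of n y] B[of y] a0[of y n] supp[of y] B0 by (cases "y \<in> {-(L+1)..L+1}") auto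
    then show "AE y in lborel. norm \<bar>a n y - \<psi> y\<bar> \<le> indicator {-(L+1)..L+1} y * (2 * B)" for n by simp
  qed auto
  then have lim1: "(\<lambda>n. \<integral>y. \<bar>a n y - \<psi> y\<bar> \<partial>lborel) \<longlonglongrightarrow> 0" by simp
  have "(\<lambda>n. inverse (N n)) \<longlonglongrightarrow> 0" unfolding N_def by (rule LIMSEQ_inverse_real_of_nat)
  then have "(\<lambda>n. (\<integral>y. \<bar>a n y - \<psi> y\<bar> \<partial>lborel) + B * (2 * inverse (N n))) \<longlonglongrightarrow> 0 + B * (2 * 0)"
    by (intro tendsto_intros lim1)
  then have ev1: "\<forall>\<^sub>F n in sequentially. (\<integral>y. \<bar>a n y - \<psi> y\<bar> \<partial>lborel) + B * (2 * inverse (N n)) < \<eta>"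
    using \<eta> by (intro order_tendstoD(2)) auto
  have l1: "(\<integral>y. \<bar>g n y - \<psi> y\<bar> \<partial>lborel) \<le> (\<integral>y. \<bar>a n y - \<psi> y\<bar> \<partial>lborel) + B * (2 * inverse (N n))" for n
  proof -
    let ?I = "\<lambda>j. {d j - inverse ((N n)\<^sup>2)..d j + inverse ((N n)\<^sup>2)}"
    have "(\<integral>y. \<bar>g n y - \<psi> y\<bar> \<partial>lborel) \<le> (\<integral>y. \<bar>a n y - \<psi> y\<bar> + B * (\<Sum>j<n. indicator (?I j) y) \<partial>lborel)"
    proof (rule integral_mono)
      show "integrable lborel (\<lambda>y. \<bar>g n y - \<psi> y\<bar>)" using intg int by auto
      show "integrable lborel (\<lambda>y. \<bar>a n y - \<psi> y\<bar> + B * (\<Sum>j<n. indicator (?I j) y))"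
        using inta int by (intro Bochner_Integration.integrable_add integrable_mult_right Bochner_Integration.integrable_sum)
          (auto simp: integrable_indicator_iff emeasure_lborel_Icc_eq)
      fix y
      have "g n y - \<psi> y = (a n y - \<psi> y) - a n y * (1 - c n y)" by (simp add: g_def algebra_simps)
      then have "\<bar>g n y - \<psi> y\<bar> \<le> \<bar>a n y - \<psi> y\<bar> + \<bar>a n y\<bar> * (1 - c n y)"
        using abs_triangle_ineq4[of "a n y - \<psi> y" "a n y * (1 - c n y)"] c01[of n y] by (simp add: abs_mult)
      also have "\<bar>a n y\<bar> * (1 - c n y) \<le> B * (\<Sum>j<n. indicator (?I j) y)"
        using aB B0 c01 c_lower by (intro mult_mono) auto
      finally show "\<bar>g n y - \<psi> y\<bar> \<le> \<bar>a n y - \<psi> y\<bar> + B * (\<Sum>j<n. indicator (?I j) y)" by simp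
    qed
    also have "\<dots> = (\<integral>y. \<bar>a n y - \<psi> y\<bar> \<partial>lborel) + B * (\<Sum>j<n. (\<integral>y. indicator (?I j) y \<partial>lborel))"
      using inta int
      by (subst Bochner_Integration.integral_add)
        (auto simp: integrable_indicator_iff emeasure_lborel_Icc_eq intro!: Bochner_Integration.integrable_sum)
    also have "(\<Sum>j<n. (\<integral>y. indicator (?I j) y \<partial>lborel)) = real n * (2 * inverse ((N n)\<^sup>2))"
      using N[of n] by simp
    also have "\<dots> \<le> N n * (2 * inverse ((N n)\<^sup>2))"
      using N[of n] by (intro mult_right_mono) (auto simp: N_def)
    also have "\<dots> = 2 * inverse (N n)"
      using N[of n] by (simp add: power2_eq_square)
    finally show ?thesis using B0 by (simp add: mult_left_mono)
  qed
  \<comment> \<open>\<open>c n\<close> need not tend to 1 at a point that is approximated very fast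
    by the sequence d. An upper bound for the energy only needs \<open>c n\<close> \<le> 1 and its
    zeros, so the limit is taken with \<open>a n\<close> restricted to the complement of these
    zeros.\<close>
  define k where "k n y = indicator (- d ` {..<n}) y * \<bar>a n y\<bar> powr p" for n y
  have km [measurable]: "k n \<in> borel_measurable borel" for n
  proof -
    have "- d ` {..<n} \<in> sets borel" by (intro borel_comp finite_imp_closed borel_closed) auto
    then show ?thesis unfolding k_def by measurable
  qed
  have [measurable]: "D \<in> sets borel" by (rule sets.countable[OF _ D(1)]) auto
  have kB: "\<bar>k n y\<bar> \<le> B powr p" for n y
    using aB[of n y] p by (auto simp: k_def indicator_def intro: powr_mono2)
  have intk: "integrable M (k n)" for n
    by (rule integrable_const_bound[of _ "B powr p"]) (use kB in auto)
  have "(\<lambda>n. \<integral>y. k n y \<partial>M) \<longlonglongrightarrow> (\<integral>y. indicator (- range d) y * \<bar>\<psi> y\<bar> powr p \<partial>M)"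
  proof (rule integral_dominated_convergence[where w = "\<lambda>y. B powr p"])
    have "- range d \<in> sets borel" by (rule borel_comp, rule sets.countable) auto
    then show "(\<lambda>y. indicator (- range d) y * \<bar>\<psi> y\<bar> powr p) \<in> borel_measurable M" by measurable
    have "(\<lambda>n. k n y) \<longlonglongrightarrow> indicator (- range d) y * \<bar>\<psi> y\<bar> powr p" for y
    proof (cases "y \<in> range d")
      case True
      then obtain j where "y = d j" by auto
      then have "k n y = 0" if "n \<ge> Suc j" for n
        using that by (simp add: k_def)
      then have "(\<lambda>n. k n y) \<longlonglongrightarrow> 0"
        by (intro tendsto_eventually eventually_sequentiallyI[of "Suc j"])
      then show ?thesis using True by simp
    next
      case False
      then have "k n y = \<bar>a n y\<bar> powr p" for n
        unfolding k_def by (subst indicator_simps(1)) auto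
      moreover have "(\<lambda>n. \<bar>a n y\<bar> powr p) \<longlonglongrightarrow> \<bar>\<psi> y\<bar> powr p"
      proof (rule tendsto_powr'[OF tendsto_rabs[OF atend] tendsto_const])
        show "y \<notin> D" using False d by blast
      qed (use p in simp)
      ultimately show ?thesis using False by simp
    qed
    then show "AE y in M. (\<lambda>n. k n y) \<longlonglongrightarrow> indicator (- range d) y * \<bar>\<psi> y\<bar> powr p" by simp
    show "AE y in M. norm (k n y) \<le> B powr p" for n using kB by simp
  qed auto
  moreover have "(\<integral>y. indicator (- range d) y * \<bar>\<psi> y\<bar> powr p \<partial>M) \<le> (\<integral>y. indicator (- D) y * \<bar>\<psi> y\<bar> powr p \<partial>M)"
  proof (rule integral_mono')
    show "integrable M (\<lambda>y. indicator (- D) y * \<bar>\<psi> y\<bar> powr p)"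
      by (rule integrable_const_bound[of _ "B powr p"])
        (use B p in \<open>auto simp: indicator_def intro!: powr_mono2\<close>)
  qed (use d in \<open>auto simp: indicator_def\<close>)
  ultimately have ev2: "\<forall>\<^sub>F n in sequentially. (\<integral>y. k n y \<partial>M) < J"
    using J by (metis order_tendstoD(2) order_le_less_trans)
  obtain n where n: "(\<integral>y. \<bar>a n y - \<psi> y\<bar> \<partial>lborel) + B * (2 * inverse (N n)) < \<eta>" "(\<integral>y. k n y \<partial>M) < J"
    using eventually_happens'[OF _ eventually_conj[OF ev1 ev2]] by auto
  have "(\<integral>y. \<bar>g n y\<bar> powr p \<partial>M) \<le> (\<integral>y. k n y \<partial>M)"
  proof (rule integral_mono)
    show "integrable M (\<lambda>y. \<bar>g n y\<bar> powr p)"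
      by (rule integrable_powr_bounded[OF _ gB]) (use p in auto)
    fix y show "\<bar>g n y\<bar> powr p \<le> k n y"
    proof (cases "y \<in> d ` {..<n}")
      case True
      then obtain j where "j < n" "y = d j" by auto
      then have "c n y = 0" unfolding c_def by (intro prod_zero) (auto intro!: bexI[of _ j])
      then show ?thesis by (simp add: g_def k_def)
    next
      case False
      then show ?thesis using gabs[of n y] p by (auto simp: k_def intro: powr_mono2)
    qed
  qed (rule intk)
  then have "(\<integral>y. \<bar>g n y\<bar> powr p \<partial>M) \<le> J" using n(2) by simp
  moreover have "\<bar>primitive (g n) x - primitive \<psi> x\<bar> \<le> \<eta>" for x
    using primitive_diff_le[OF intg int, of n x] l1[of n] n(1) by linarith
  ultimately show ?thesis using that[of "g n"] contg g0 by blast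
qed

text \<open>The inequality for continuous approximants passes to the limit because their primitives
  converge uniformly. The set D drops out of the energy although it may have positive mass; this is
  what the pullback relies on.\<close>

lemma (in real_distribution) Lp_admissible_primitive:
  fixes \<psi> :: "real \<Rightarrow> real"
  assumes adm: "Lp_admissible p M C" and C: "0 < C" "C < C'" and \<epsilon>: "0 < \<epsilon>"
    and p: "p \<ge> 1" and meas: "\<psi> \<in> borel_measurable borel"
    and B: "\<And>x. \<bar>\<psi> x\<bar> \<le> B" and supp: "\<And>x. x \<notin> {-L..L} \<Longrightarrow> \<psi> x = 0"
    and D: "countable D" "\<And>y. y \<notin> D \<Longrightarrow> isCont \<psi> y"
  shows "\<exists>a. (\<integral>x. \<bar>primitive \<psi> x - a\<bar> powr p \<partial>M)
             \<le> C' * (\<integral>x. indicator (- D) x * \<bar>\<psi> x\<bar> powr p \<partial>M) + \<epsilon>"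
proof -
  define J where "J = (\<integral>x. indicator (- D) x * \<bar>\<psi> x\<bar> powr p \<partial>M)"
  \<comment> \<open>Chosen so that \<theta>^(-p) = C' / C; the factor \<theta>^(1-p) of
    \<open>powr_abs_add_le\<close> then turns C into at most C'.\<close>
  define \<theta> where "\<theta> = (C / C') powr (1 / p)"
  have \<theta>: "0 < \<theta>" "\<theta> < 1"
    using C p powr_less_mono2[of "1/p" "C/C'" 1] by (auto simp: \<theta>_def)
  have "\<theta> powr (1 - p) * C \<le> \<theta> powr (- p) * C"
    using \<theta> C p by (intro mult_right_mono powr_mono') auto
  also have "\<theta> powr (- p) = C' / C"
    using C p by (simp add: \<theta>_def powr_powr powr_minus_divide)
  finally have \<theta>C: "\<theta> powr (1 - p) * C \<le> C'" using C by simp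
  \<comment> \<open>The errors in the energy, in the choice of a and in the primitive each
    contribute \<epsilon> / 3 to the final estimate.\<close>
  define \<delta> where "\<delta> = \<epsilon> / (3 * C')"
  define \<epsilon>' where "\<epsilon>' = \<epsilon> / (3 * \<theta> powr (1 - p))"
  define \<eta> where "\<eta> = (\<epsilon> / (3 * (1 - \<theta>) powr (1 - p))) powr (1 / p)"
  have pos: "\<delta> > 0" "\<epsilon>' > 0" "\<eta> > 0" using \<epsilon> C \<theta> by (auto simp: \<delta>_def \<epsilon>'_def \<eta>_def)
  obtain g where g: "continuous_on UNIV g" "\<And>x. x \<notin> {-(L+1)..L+1} \<Longrightarrow> g x = 0"
    "\<And>x. \<bar>primitive g x - primitive \<psi> x\<bar> \<le> \<eta>" "(\<integral>x. \<bar>g x\<bar> powr p \<partial>M) \<le> J + \<delta>"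
    by (rule continuous_approximants[OF p meas B supp D, of L "J + \<delta>" \<eta>]) (use pos in \<open>auto simp: J_def\<close>)
  note G = primitive_test_function[OF g(1,2)]
  obtain a where a: "(\<integral>x. \<bar>primitive g x - a\<bar> powr p \<partial>M) \<le> C * (\<integral>x. \<bar>g x\<bar> powr p \<partial>M) + \<epsilon>'"
    using adm G pos(2) unfolding Lp_admissible_def by metis
  obtain K where K: "\<And>x. \<bar>primitive g x\<bar> \<le> K" using test_function_bounded[OF G(1)] by metis
  have [measurable]: "primitive g \<in> borel_measurable borel" by (rule test_function_measurable[OF G(1)])
  have [measurable]: "primitive \<psi> \<in> borel_measurable borel"
    using isCont_primitive[OF integrable_bounded_support[OF meas B supp] B, of L]
    by (intro borel_measurable_continuous_onI continuous_at_imp_continuous_on) auto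
  have i1: "integrable M (\<lambda>x. \<bar>primitive g x - a\<bar> powr p)"
    by (rule integrable_powr_bounded[where B = "K + \<bar>a\<bar>"])
      (use p K in \<open>auto intro: order_trans[OF abs_triangle_ineq4] add_right_mono\<close>)
  have "(\<integral>x. \<bar>primitive \<psi> x - a\<bar> powr p \<partial>M)
    \<le> (\<integral>x. \<theta> powr (1 - p) * \<bar>primitive g x - a\<bar> powr p + (1 - \<theta>) powr (1 - p) * \<eta> powr p \<partial>M)"
  proof (rule integral_mono')
    fix x
    have "\<bar>primitive \<psi> x - a\<bar> powr p = \<bar>(primitive g x - a) + (primitive \<psi> x - primitive g x)\<bar> powr p" by simp
    also have "\<dots> \<le> \<theta> powr (1 - p) * \<bar>primitive g x - a\<bar> powr p
        + (1 - \<theta>) powr (1 - p) * \<bar>primitive \<psi> x - primitive g x\<bar> powr p"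
      by (rule powr_abs_add_le[OF p \<theta>])
    also have "\<bar>primitive \<psi> x - primitive g x\<bar> powr p \<le> \<eta> powr p"
      using g(3)[of x] p by (intro powr_mono2) (auto simp: abs_minus_commute)
    finally show "\<bar>primitive \<psi> x - a\<bar> powr p
        \<le> \<theta> powr (1 - p) * \<bar>primitive g x - a\<bar> powr p + (1 - \<theta>) powr (1 - p) * \<eta> powr p"
      by (simp add: mult_left_mono)
  qed (use i1 in auto)
  also have "\<dots> = \<theta> powr (1 - p) * (\<integral>x. \<bar>primitive g x - a\<bar> powr p \<partial>M) + (1 - \<theta>) powr (1 - p) * \<eta> powr p"
    using i1 prob_space by simp
  also have "(1 - \<theta>) powr (1 - p) * \<eta> powr p = \<epsilon> / 3"
    using \<epsilon> \<theta> p by (simp add: \<eta>_def powr_powr)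
  also have "\<theta> powr (1 - p) * (\<integral>x. \<bar>primitive g x - a\<bar> powr p \<partial>M) \<le> \<theta> powr (1 - p) * (C * (J + \<delta>) + \<epsilon>')"
    using a g(4) C by (intro mult_left_mono order_trans[OF a] add_right_mono mult_left_mono) auto
  also have "\<dots> = (\<theta> powr (1 - p) * C) * (J + \<delta>) + \<epsilon> / 3"
    using \<theta> by (simp add: \<epsilon>'_def algebra_simps)
  also have "(\<theta> powr (1 - p) * C) * (J + \<delta>) \<le> C' * (J + \<delta>)"
    using \<theta>C pos by (intro mult_right_mono) (auto simp: J_def intro!: add_nonneg_nonneg)
  also have "C' * (J + \<delta>) = C' * J + \<epsilon> / 3" using C by (simp add: \<delta>_def algebra_simps)
  finally show ?thesis unfolding J_def by (intro exI[of _ a]) simp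
qed

section \<open>Pullback along a monotone map\<close>

lemma (in real_distribution) real_distribution_distr_borel:
  "T \<in> borel_measurable borel \<Longrightarrow> real_distribution (distr M borel T)"
  by (rule real_distribution_distr) simp

text \<open>
  \<open>G\<close> is the Stieltjes primitive of \<open>\<phi>\<close> with respect to \<open>T\<close>. It factors through \<open>T\<close>, hence inherits a
  Poincare inequality from the image of \<open>M\<close> under \<open>T\<close>; the flat pieces of \<open>T\<close> do not contribute to it.
\<close>

lemma (in real_distribution) Lp_admissible_pullback:
  fixes T \<phi> :: "real \<Rightarrow> real"
  assumes T: "mono T" and adm: "Lp_admissible p (distr M borel T) C"
    and C: "0 < C" "C < C'" and p: "p \<ge> 1"
    and cont: "continuous_on UNIV \<phi>" and R: "R > 0" and supp: "\<And>x. R \<le> \<bar>x\<bar> \<Longrightarrow> \<phi> x = 0"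
  obtains G where "G \<in> borel_measurable borel" "bounded (range G)"
    "\<And>a b c e. a \<le> b \<Longrightarrow> (\<And>z. a \<le> z \<Longrightarrow> z \<le> b \<Longrightarrow> \<bar>\<phi> z - c\<bar> \<le> e) \<Longrightarrow>
       \<bar>G b - G a - c * (T b - T a)\<bar> \<le> e * (T b - T a)"
    "\<And>\<epsilon>. \<epsilon> > 0 \<Longrightarrow> \<exists>a. (\<integral>x. \<bar>G x - a\<bar> powr p \<partial>M) \<le> C' * (\<integral>x. \<bar>\<phi> x\<bar> powr p \<partial>M) + \<epsilon>"
proof -
  have "bounded (\<phi> ` {-R..R})"
    by (intro compact_imp_bounded compact_continuous_image continuous_on_subset[OF cont]) auto
  then obtain B0 where B0: "\<And>x. x \<in> {-R..R} \<Longrightarrow> \<bar>\<phi> x\<bar> \<le> B0"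
    unfolding bounded_iff by (metis imageI real_norm_def)
  have B: "\<bar>\<phi> x\<bar> \<le> max B0 0" for x
  proof (cases "x \<in> {-R..R}")
    case True then show ?thesis using B0[OF True] by linarith
  next
    case False
    then have "R \<le> \<bar>x\<bar>" unfolding atLeastAtMost_iff by linarith
    then show ?thesis using supp[of x] by simp
  qed
  \<comment> \<open>A generalised inverse of T, clamped to [-R, R]. Clamping is harmless because
    \<phi> vanishes at R, at -R and beyond; the inserted -R keeps the set nonempty.\<close>
  define S where "S y = Sup (insert (- R) {x. - R \<le> x \<and> x \<le> R \<and> T x \<le> y})" for y
  have bdd: "bdd_above (insert (- R) {x. - R \<le> x \<and> x \<le> R \<and> T x \<le> y})" for y
    using R by (intro bdd_aboveI[of _ R]) auto
  have S_ge: "- R \<le> S y" for y unfolding S_def by (intro cSup_upper bdd) auto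
  have S_upper: "x \<le> S y" if "- R \<le> x" "x \<le> R" "T x \<le> y" for x y
    unfolding S_def using that by (intro cSup_upper bdd) auto
  have S_le: "S y \<le> R" for y unfolding S_def using R by (intro cSup_least) auto
  have S_least: "S y \<le> b" if "y < T b" "- R \<le> b" for y b
    unfolding S_def
  proof (rule cSup_least)
    fix x assume "x \<in> insert (- R) {x. - R \<le> x \<and> x \<le> R \<and> T x \<le> y}"
    then have "x = - R \<or> T x < T b" using that(1) by force
    then show "x \<le> b" using that(2) monoD[OF T, of b x] by linarith
  qed simp
  have S_mono: "mono S" unfolding S_def
    by (intro monoI cSup_subset_mono bdd) auto
  have S_low: "S y = - R" if "y < T (- R)" for y
    using S_least[OF that] S_ge[of y] by simp
  have S_high: "S y = R" if "T R \<le> y" for y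
    using S_upper[of R y] S_le[of y] that R by simp
  define D where "D = {y. \<not> isCont S y}"
  have D: "countable D" unfolding D_def by (rule mono_ctble_discont[OF S_mono])
  define \<psi> where "\<psi> y = \<phi> (S y)" for y
  have cont\<psi>: "isCont \<psi> y" if "y \<notin> D" for y
    unfolding \<psi>_def using that cont
    by (intro isCont_o2[where f = S and g = \<phi>]) (auto simp: D_def continuous_on_eq_continuous_at)
  have [measurable]: "\<phi> \<in> borel_measurable borel" by (rule borel_measurable_continuous_onI[OF cont])
  have [measurable]: "S \<in> borel_measurable borel" by (rule borel_measurable_mono[OF S_mono])
  have [measurable]: "T \<in> borel_measurable borel" by (rule borel_measurable_mono[OF T])
  have \<psi>m [measurable]: "\<psi> \<in> borel_measurable borel" unfolding \<psi>_def by measurable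
  define L where "L = max \<bar>T (- R)\<bar> \<bar>T R\<bar>"
  have \<psi>B: "\<bar>\<psi> y\<bar> \<le> max B0 0" for y unfolding \<psi>_def by (rule B)
  have \<psi>0: "\<psi> y = 0" if "y \<notin> {-L..L}" for y
  proof -
    have "y < T (- R) \<or> T R \<le> y" using that unfolding L_def atLeastAtMost_iff by linarith
    then have "S y = - R \<or> S y = R" using S_low[of y] S_high[of y] by blast
    then show ?thesis using supp[of R] supp[of "-R"] R by (auto simp: \<psi>_def)
  qed
  have int: "integrable lborel \<psi>" by (rule integrable_bounded_support[OF \<psi>m \<psi>B \<psi>0])
  \<comment> \<open>The substitution y = T z makes this the integral of \<phi> against dT up to x;
    at a jump of T, S is constant across the gap, which yields the jump term.\<close>
  define G where "G x = primitive \<psi> (T x)" for x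
  have primm [measurable]: "primitive \<psi> \<in> borel_measurable borel"
    by (intro borel_measurable_continuous_onI continuous_at_imp_continuous_on ballI isCont_primitive[OF int \<psi>B])
  have G1: "G \<in> borel_measurable borel" unfolding G_def by measurable
  have G2: "bounded (range G)"
  proof (rule boundedI)
    fix z assume "z \<in> range G"
    then obtain x where z: "z = G x" by auto
    have "\<bar>primitive \<psi> (T x) - primitive (\<lambda>_. 0) (T x)\<bar> \<le> (\<integral>x. \<bar>\<psi> x - 0\<bar> \<partial>lborel)"
      by (rule primitive_diff_le[OF int]) simp
    then show "norm z \<le> (\<integral>x. \<bar>\<psi> x\<bar> \<partial>lborel)" by (simp add: z G_def primitive_def)
  qed
  have G3: "\<bar>G b - G a - c * (T b - T a)\<bar> \<le> e * (T b - T a)"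
    if ab: "a \<le> b" and e: "\<And>z. a \<le> z \<Longrightarrow> z \<le> b \<Longrightarrow> \<bar>\<phi> z - c\<bar> \<le> e" for a b c e
    unfolding G_def
  proof (rule primitive_increment[OF int])
    show "T a \<le> T b" using T ab by (rule monoD)
    fix y assume y: "T a < y" "y < T b"
    \<comment> \<open>S maps the open interval from T a to T b into [a, b], unless clamping
      interferes. In that case [a, b] lies beyond R or -R, and \<phi> is 0 both at S y and on
      [a, b].\<close>
    have "\<exists>z. a \<le> z \<and> z \<le> b \<and> \<psi> y = \<phi> z"
    proof -
      consider "R < a" | "b < - R" | "a \<le> R" "- R \<le> b" by linarith
      then show ?thesis
      proof cases
        case 1
        then have "S y = R" using y T[THEN monoD, of R a] by (intro S_high) simp
        then show ?thesis using 1 ab R supp[of R] supp[of a] by (intro exI[of _ a]) (simp add: \<psi>_def)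
      next
        case 2
        then have "S y = - R" using y T[THEN monoD, of b "-R"] by (intro S_low) simp
        then show ?thesis using 2 ab R supp[of "-R"] supp[of b] by (intro exI[of _ b]) (simp add: \<psi>_def)
      next
        case 3
        have "a \<le> S y" using S_ge[of y] S_upper[of a y] y 3 by (cases "- R \<le> a") auto
        moreover have "S y \<le> b" using S_least[of y b] y 3 by simp
        ultimately show ?thesis by (auto simp: \<psi>_def)
      qed
    qed
    then show "\<bar>\<psi> y - c\<bar> \<le> e" using e by auto
  qed
  have G4: "\<exists>a. (\<integral>x. \<bar>G x - a\<bar> powr p \<partial>M) \<le> C' * (\<integral>x. \<bar>\<phi> x\<bar> powr p \<partial>M) + \<epsilon>" if \<epsilon>: "\<epsilon> > 0" for \<epsilon>
  proof -
    interpret T: real_distribution "distr M borel T" by (rule real_distribution_distr_borel) measurable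
    obtain a where a: "(\<integral>x. \<bar>primitive \<psi> x - a\<bar> powr p \<partial>distr M borel T)
             \<le> C' * (\<integral>x. indicator (- D) x * \<bar>\<psi> x\<bar> powr p \<partial>distr M borel T) + \<epsilon>"
      using T.Lp_admissible_primitive[OF adm C \<epsilon> p \<psi>m \<psi>B \<psi>0 D cont\<psi>] by blast
    have Dm [measurable]: "- D \<in> sets borel" by (rule borel_comp, rule sets.countable[OF _ D]) auto
    \<comment> \<open>If S is continuous at T x, its value is the limit from the left. For y < T x
      every point that T sends to at most y lies below x, whence S (T x) \<le> x up to clamping; the
      reverse bound holds by definition of S. So S (T x) = x inside [-R, R], which can fail on a
      flat piece of T.\<close>
    have le: "indicator (- D) (T x) * \<bar>\<psi> (T x)\<bar> powr p \<le> \<bar>\<phi> x\<bar> powr p" for x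
    proof (cases "T x \<in> D")
      case False
      then have "isCont S (T x)" by (simp add: D_def)
      then have "(S \<longlongrightarrow> S (T x)) (at_left (T x))" unfolding isCont_def by (rule tendsto_within_subset) simp
      moreover have "\<forall>\<^sub>F y in at_left (T x). S y \<le> max x (- R)"
      proof -
        have "S y \<le> max x (- R)" if "y < T x" for y
          using that T[THEN monoD, of x "max x (- R)"] by (intro S_least) auto
        then show ?thesis by (auto simp: eventually_at_filter)
      qed
      ultimately have 1: "S (T x) \<le> max x (- R)"
        by (rule tendsto_upperbound) simp
      have 2: "min x R \<le> S (T x)" if "- R \<le> x"
        using that R T[THEN monoD, of "min x R" x] by (intro S_upper) auto
      have "\<phi> (S (T x)) = \<phi> x"
      proof -
        consider "x \<le> - R" | "- R \<le> x" "x \<le> R" | "R \<le> x" by linarith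
        then show ?thesis
        proof cases
          case 1
          then have "S (T x) = - R" using \<open>S (T x) \<le> max x (- R)\<close> S_ge[of "T x"] by simp
          then show ?thesis using supp[of "-R"] supp[of x] R 1 by simp
        next
          case 2
          then have "S (T x) = x" using \<open>S (T x) \<le> max x (- R)\<close> \<open>- R \<le> x \<Longrightarrow> min x R \<le> S (T x)\<close> by simp
          then show ?thesis by simp
        next
          case 3
          then have "S (T x) = R" using \<open>- R \<le> x \<Longrightarrow> min x R \<le> S (T x)\<close> S_le[of "T x"] R by simp
          then show ?thesis using supp[of R] supp[of x] R 3 by simp
        qed
      qed
      then show ?thesis using False by (simp add: \<psi>_def)
    qed simp
    have "(\<integral>x. \<bar>G x - a\<bar> powr p \<partial>M) = (\<integral>x. \<bar>primitive \<psi> x - a\<bar> powr p \<partial>distr M borel T)"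
      by (subst integral_distr) (auto simp: G_def)
    also note a
    also have "(\<integral>x. indicator (- D) x * \<bar>\<psi> x\<bar> powr p \<partial>distr M borel T)
        = (\<integral>x. indicator (- D) (T x) * \<bar>\<psi> (T x)\<bar> powr p \<partial>M)"
      by (subst integral_distr) auto
    also have "\<dots> \<le> (\<integral>x. \<bar>\<phi> x\<bar> powr p \<partial>M)"
      by (rule integral_mono'[OF integrable_powr_bounded[OF _ B] le]) (use p in auto)
    finally show ?thesis using C by (auto intro!: exI[of _ a] simp: mult_left_mono)
  qed
  show ?thesis by (rule that[OF G1 G2 G3 G4])
qed

text \<open>
  On the range of \<open>(1 - t) * Q0 + t * Q1\<close> both \<open>Q0\<close> and \<open>Q1\<close> are Lipschitz functions of the
  combination; \<open>T0\<close> is the McShane extension.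
\<close>

lemma monotone_splitting:
  fixes Q0 Q1 Q :: "real \<Rightarrow> real"
  assumes mono: "mono_on S Q0" "mono_on S Q1" and S: "S \<noteq> {}" and t: "0 < t" "t < 1"
    and Q: "\<And>u. Q u = (1 - t) * Q0 u + t * Q1 u"
  obtains T0 T1 where "mono T0" "mono T1" "\<And>x. (1 - t) * T0 x + t * T1 x = x"
    "\<And>u. u \<in> S \<Longrightarrow> T0 (Q u) = Q0 u" "\<And>u. u \<in> S \<Longrightarrow> T1 (Q u) = Q1 u"
proof -
  \<comment> \<open>As Q1 is nondecreasing, (1 - t) * (Q0 v - Q0 u) \<le> Q v - Q u for u \<le> v,
    so Q0 is K-Lipschitz as a function of Q. The same constant for T0 makes x - (1 - t) * T0 x
    nondecreasing, hence T1 monotone.\<close>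
  define K where "K = 1 / (1 - t)"
  have K: "K > 0" "(1 - t) * K = 1" using t by (auto simp: K_def)
  \<comment> \<open>The positive part replaces the absolute value of the usual McShane formula: it
    makes \<open>h\<close> nondecreasing in x, and with it the infimum.\<close>
  define h where "h x u = Q0 u + K * max 0 (x - Q u)" for x u
  define T0 where "T0 x = (INF u\<in>S. h x u)" for x
  define T1 where "T1 x = (x - (1 - t) * T0 x) / t" for x
  have KQ: "K * Q u = Q0 u + K * t * Q1 u" for u
    using K(2) by (simp add: Q distrib_left mult.assoc[symmetric] mult.commute[of K])
  obtain w where w: "w \<in> S" using S by auto
  \<comment> \<open>Q0 may be unbounded below on S, so the infimum needs a lower bound. For u below
    w the term Q0 u cancels: Q0 u + K * (x - Q u) = K * x - K * t * Q1 u, and Q1 u \<le> Q1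
    w.\<close>
  have h_ge: "min (Q0 w) (K * x - K * t * Q1 w) \<le> h x u" if u: "u \<in> S" for x u
  proof (cases "w \<le> u")
    case True
    then have "Q0 w \<le> Q0 u" using mono(1) u w by (auto dest: mono_onD)
    moreover have "0 \<le> K * max 0 (x - Q u)" using K by simp
    ultimately show ?thesis unfolding h_def by linarith
  next
    case False
    then have "Q1 u \<le> Q1 w" using mono(2) u w by (auto dest: mono_onD)
    then have "K * t * Q1 u \<le> K * t * Q1 w" using K t by (intro mult_left_mono) auto
    moreover have "K * (x - Q u) \<le> K * max 0 (x - Q u)" using K by (intro mult_left_mono) auto
    ultimately show ?thesis unfolding h_def right_diff_distrib KQ by linarith
  qed
  have bdd: "bdd_below (h x ` S)" for x
    using h_ge by (intro bdd_belowI[of _ "min (Q0 w) (K * x - K * t * Q1 w)"]) auto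
  have le: "T0 x \<le> h x u" if "u \<in> S" for x u unfolding T0_def by (rule cINF_lower[OF bdd that])
  have ge: "c \<le> T0 x" if "\<And>u. u \<in> S \<Longrightarrow> c \<le> h x u" for x c
    unfolding T0_def by (rule cINF_greatest[OF S that])
  have 1: "mono T0"
  proof (intro monoI ge)
    fix x y u :: real assume "x \<le> y" "u \<in> S"
    then have "K * max 0 (x - Q u) \<le> K * max 0 (y - Q u)" using K by (intro mult_left_mono) auto
    then have "h x u \<le> h y u" by (simp add: h_def)
    then show "T0 x \<le> h y u" using le[OF \<open>u \<in> S\<close>, of x] by simp
  qed
  have Lip: "T0 y - K * (y - x) \<le> T0 x" if "x \<le> y" for x y
  proof (rule ge)
    fix u assume u: "u \<in> S"
    have "K * max 0 (y - Q u) \<le> K * (max 0 (x - Q u) + (y - x))"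
      using K that by (intro mult_left_mono) auto
    then have "h y u - K * (y - x) \<le> h x u" by (simp add: h_def distrib_left)
    then show "T0 y - K * (y - x) \<le> h x u" using le[OF u, of y] by simp
  qed
  have 2: "mono T1"
  proof (rule monoI)
    fix x y :: real assume "x \<le> y"
    then have "(1 - t) * (T0 y - K * (y - x)) \<le> (1 - t) * T0 x" using Lip t by (intro mult_left_mono) auto
    then have "(1 - t) * T0 y - (y - x) \<le> (1 - t) * T0 x"
      using K(2) by (simp add: right_diff_distrib mult.assoc[symmetric])
    then show "T1 x \<le> T1 y" using t by (auto simp: T1_def intro!: divide_right_mono)
  qed
  have 3: "(1 - t) * T0 x + t * T1 x = x" for x using t by (simp add: T1_def)
  have 4: "T0 (Q v) = Q0 v" if v: "v \<in> S" for v
  proof (rule antisym)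
    show "T0 (Q v) \<le> Q0 v" using le[OF v, of "Q v"] by (simp add: h_def)
    show "Q0 v \<le> T0 (Q v)"
    proof (rule ge)
      fix u assume u: "u \<in> S"
      show "Q0 v \<le> h (Q v) u"
      proof (cases "v \<le> u")
        case True
        then have "Q0 v \<le> Q0 u" using mono(1) u v by (auto dest: mono_onD)
        moreover have "0 \<le> K * max 0 (Q v - Q u)" using K by simp
        ultimately show ?thesis unfolding h_def by linarith
      next
        case False
        then have "Q1 u \<le> Q1 v" using mono(2) u v by (auto dest: mono_onD)
        then have "K * t * Q1 u \<le> K * t * Q1 v" using K t by (intro mult_left_mono) auto
        moreover have "K * (Q v - Q u) \<le> K * max 0 (Q v - Q u)" using K by (intro mult_left_mono) auto
        ultimately show ?thesis unfolding h_def right_diff_distrib KQ by linarith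
      qed
    qed
  qed
  have 5: "T1 (Q v) = Q1 v" if "v \<in> S" for v
    using 4[OF that] t by (simp add: T1_def Q)
  show ?thesis using that[OF 1 2 3 4 5] by blast
qed

section \<open>Triangle inequality for the two pulled-back primitives\<close>

text \<open>The weighted increments of T0 and T1 add up to b - a. Hence the two Stieltjes estimates
  combine into the hypothesis of \<open>DERIV_from_increments\<close>, and (1 - t) * G0 + t * G1 is
  a classical primitive of f'.\<close>

lemma (in real_distribution) Lp_admissible_combination:
  fixes T0 T1 :: "real \<Rightarrow> real"
  assumes T: "mono T0" "mono T1" "\<And>x. (1 - t) * T0 x + t * T1 x = x" and t: "0 < t" "t < 1"
    and p: "p \<ge> 1" and K: "0 < K0" "K0 < K0'" "0 < K1" "K1 < K1'"
    and adm: "Lp_admissible p (distr M borel T0) (K0 powr p)" "Lp_admissible p (distr M borel T1) (K1 powr p)"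
  shows "Lp_admissible p M (((1 - t) * K0' + t * K1') powr p)"
  unfolding Lp_admissible_def
proof (intro ballI allI impI)
  fix f and \<epsilon> :: real assume f: "f \<in> test_functions" and \<epsilon>: "\<epsilon> > 0"
  obtain L where L: "L > 0" "\<And>x. x \<notin> {-L..L} \<Longrightarrow> deriv f x = 0" "continuous_on UNIV (deriv f)"
    and D: "\<And>x. (f has_real_derivative deriv f x) (at x)"
    using test_functionE[OF f] by metis
  \<comment> \<open>One unit of room makes f' vanish at R and -R themselves, where the generalised
    inverse is clamped.\<close>
  define R where "R = L + 1"
  have R: "R > 0" "\<And>x. R \<le> \<bar>x\<bar> \<Longrightarrow> deriv f x = 0"
    using L(1) by (auto simp: R_def intro!: L(2))
  have Kp: "0 < K0 powr p" "K0 powr p < K0' powr p" "0 < K1 powr p" "K1 powr p < K1' powr p"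
    using K p by (auto intro: powr_less_mono2)
  define I where "I = (\<integral>x. \<bar>deriv f x\<bar> powr p \<partial>M)"
  obtain G0 where G0: "G0 \<in> borel_measurable borel" "bounded (range G0)"
    "\<And>a b c e. a \<le> b \<Longrightarrow> (\<And>z. a \<le> z \<Longrightarrow> z \<le> b \<Longrightarrow> \<bar>deriv f z - c\<bar> \<le> e) \<Longrightarrow>
       \<bar>G0 b - G0 a - c * (T0 b - T0 a)\<bar> \<le> e * (T0 b - T0 a)"
    "\<And>\<epsilon>. \<epsilon> > 0 \<Longrightarrow> \<exists>a. (\<integral>x. \<bar>G0 x - a\<bar> powr p \<partial>M) \<le> K0' powr p * I + \<epsilon>"
    using Lp_admissible_pullback[OF T(1) adm(1) Kp(1,2) p L(3) R] unfolding I_def by metis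
  obtain G1 where G1: "G1 \<in> borel_measurable borel" "bounded (range G1)"
    "\<And>a b c e. a \<le> b \<Longrightarrow> (\<And>z. a \<le> z \<Longrightarrow> z \<le> b \<Longrightarrow> \<bar>deriv f z - c\<bar> \<le> e) \<Longrightarrow>
       \<bar>G1 b - G1 a - c * (T1 b - T1 a)\<bar> \<le> e * (T1 b - T1 a)"
    "\<And>\<epsilon>. \<epsilon> > 0 \<Longrightarrow> \<exists>a. (\<integral>x. \<bar>G1 x - a\<bar> powr p \<partial>M) \<le> K1' powr p * I + \<epsilon>"
    using Lp_admissible_pullback[OF T(2) adm(2) Kp(3,4) p L(3) R] unfolding I_def by metis
  define H where "H x = (1 - t) * G0 x + t * G1 x" for x
  have "(H has_real_derivative deriv f x) (at x)" for x
  proof (rule DERIV_from_increments)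
    show "isCont (deriv f) x" using L(3) by (simp add: continuous_on_eq_continuous_at)
    fix a b c e :: real
    assume ab: "a \<le> b" and e: "\<And>z. a \<le> z \<Longrightarrow> z \<le> b \<Longrightarrow> \<bar>deriv f z - c\<bar> \<le> e"
    define X where "X = (1 - t) * (G0 b - G0 a - c * (T0 b - T0 a))"
    define Y where "Y = t * (G1 b - G1 a - c * (T1 b - T1 a))"
    have "\<bar>X\<bar> \<le> (1 - t) * (e * (T0 b - T0 a))" "\<bar>Y\<bar> \<le> t * (e * (T1 b - T1 a))"
      using t G0(3)[OF ab e] G1(3)[OF ab e] by (auto simp: X_def Y_def abs_mult)
    moreover have ba: "b - a = (1 - t) * (T0 b - T0 a) + t * (T1 b - T1 a)"
      using T(3)[of a] T(3)[of b] by (simp add: algebra_simps)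
    have "(1 - t) * (e * (T0 b - T0 a)) + t * (e * (T1 b - T1 a)) = e * (b - a)"
      unfolding ba by (simp add: algebra_simps)
    moreover have "H b - H a - c * (b - a) = X + Y"
      unfolding ba H_def X_def Y_def by (simp add: algebra_simps)
    ultimately show "\<bar>H b - H a - c * (b - a)\<bar> \<le> e * (b - a)" by linarith
  qed
  then have "((\<lambda>x. f x - H x) has_real_derivative 0) (at x)" for x
    using DERIV_diff[OF D] by (metis diff_self)
  then obtain k where k: "\<And>x. f x - H x = k"
    using DERIV_const_ratio_const by (metis DERIV_isconst_all)
  define K where "K = (1 - t) * K0' + t * K1'"
  \<comment> \<open>Weights proportional to the two contributions to K. Rescaling G0 and G1 by K /
    K0' and K / K1' gives both terms the same bound K^p, so Jensen's inequality returns exactly K^p,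
    as Minkowski's inequality would.\<close>
  define \<theta> where "\<theta> = (1 - t) * K0' / K"
  have pos: "0 < K" using K(1-4) t by (auto simp: K_def intro!: add_pos_pos)
  have \<theta>: "0 < \<theta>" "\<theta> < 1" "1 - \<theta> = t * K1' / K"
    using K(1-4) t pos by (auto simp: \<theta>_def K_def field_simps)
  define A where "A = \<theta> * (K / K0') powr p"
  define B where "B = (1 - \<theta>) * (K / K1') powr p"
  have AB: "0 < A" "0 < B" using \<theta>(1,2) pos K(1-4) by (auto simp: A_def B_def)
  have AK: "A * K0' powr p = \<theta> * K powr p" "B * K1' powr p = (1 - \<theta>) * K powr p"
    using pos K(1-4) by (auto simp: A_def B_def powr_divide)
  define \<delta> where "\<delta> = \<epsilon> / (A + B)"
  have \<delta>: "\<delta> > 0" "(A + B) * \<delta> = \<epsilon>" using \<epsilon> AB by (auto simp: \<delta>_def)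
  obtain a0 where a0: "(\<integral>x. \<bar>G0 x - a0\<bar> powr p \<partial>M) \<le> K0' powr p * I + \<delta>" using G0(4)[OF \<delta>(1)] by blast
  obtain a1 where a1: "(\<integral>x. \<bar>G1 x - a1\<bar> powr p \<partial>M) \<le> K1' powr p * I + \<delta>" using G1(4)[OF \<delta>(1)] by blast
  have integrable: "integrable M (\<lambda>x. \<bar>G x - a\<bar> powr p)"
    if G: "G \<in> borel_measurable borel" "bounded (range G)" for G :: "real \<Rightarrow> real" and a
  proof -
    obtain b where "\<And>x. \<bar>G x\<bar> \<le> b" using G(2) by (auto simp: bounded_iff)
    then show ?thesis
      using p G(1) by (intro integrable_powr_bounded[of _ "b + \<bar>a\<bar>"])
        (auto intro: order_trans[OF abs_triangle_ineq4] add_right_mono)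
  qed
  define a where "a = k + (1 - t) * a0 + t * a1"
  have pw: "\<bar>f x - a\<bar> powr p \<le> A * \<bar>G0 x - a0\<bar> powr p + B * \<bar>G1 x - a1\<bar> powr p" for x
  proof -
    have "f x - a = (1 - t) * (G0 x - a0) + t * (G1 x - a1)"
      using k[of x] by (simp add: H_def a_def algebra_simps)
    then have "\<bar>f x - a\<bar> \<le> (1 - t) * \<bar>G0 x - a0\<bar> + t * \<bar>G1 x - a1\<bar>"
      using t abs_triangle_ineq[of "(1 - t) * (G0 x - a0)" "t * (G1 x - a1)"] by (simp add: abs_mult)
    also have "\<dots> = \<theta> * (K / K0' * \<bar>G0 x - a0\<bar>) + (1 - \<theta>) * (K / K1' * \<bar>G1 x - a1\<bar>)"
      unfolding \<theta>(3) using pos K(1-4) by (simp add: \<theta>_def)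
    finally have "\<bar>f x - a\<bar> powr p \<le> (\<theta> * (K / K0' * \<bar>G0 x - a0\<bar>) + (1 - \<theta>) * (K / K1' * \<bar>G1 x - a1\<bar>)) powr p"
      using p by (intro powr_mono2) auto
    also have "\<dots> \<le> \<theta> * (K / K0' * \<bar>G0 x - a0\<bar>) powr p + (1 - \<theta>) * (K / K1' * \<bar>G1 x - a1\<bar>) powr p"
      using \<theta> pos K(1-4) by (intro powr_convex_combination p) auto
    also have "\<dots> = A * \<bar>G0 x - a0\<bar> powr p + B * \<bar>G1 x - a1\<bar> powr p"
      using pos K(1-4) by (simp add: A_def B_def powr_mult del: times_divide_eq_left times_divide_eq_right)
    finally show ?thesis .
  qed
  have "(\<integral>x. \<bar>f x - a\<bar> powr p \<partial>M) \<le> (\<integral>x. A * \<bar>G0 x - a0\<bar> powr p + B * \<bar>G1 x - a1\<bar> powr p \<partial>M)"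
    by (rule integral_mono'[OF _ pw])
      (use AB in \<open>auto intro!: Bochner_Integration.integrable_add integrable_mult_right integrable G0 G1\<close>)
  also have "\<dots> = A * (\<integral>x. \<bar>G0 x - a0\<bar> powr p \<partial>M) + B * (\<integral>x. \<bar>G1 x - a1\<bar> powr p \<partial>M)"
    using integrable[OF G0(1,2)] integrable[OF G1(1,2)] by simp
  also have "\<dots> \<le> A * (K0' powr p * I + \<delta>) + B * (K1' powr p * I + \<delta>)"
    using AB a0 a1 by (intro add_mono mult_left_mono) auto
  also have "\<dots> = (A * K0' powr p) * I + (B * K1' powr p) * I + (A + B) * \<delta>"
    by (simp add: algebra_simps)
  also have "\<dots> = K powr p * I + \<epsilon>"
    unfolding AK \<delta>(2) by (simp add: algebra_simps)
  finally show "\<exists>a. (\<integral>x. \<bar>f x - a\<bar> powr p \<partial>M)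
      \<le> ((1 - t) * K0' + t * K1') powr p * (\<integral>x. \<bar>deriv f x\<bar> powr p \<partial>M) + \<epsilon>"
    unfolding K_def I_def by blast
qed

section \<open>Interpolation of the constants\<close>

lemma (in real_distribution) ennreal_Poincare_iff:
  assumes p: "p \<ge> 0" and C: "C \<ge> 0" and f: "f \<in> test_functions"
  shows "(INF a::real. \<integral>\<^sup>+ x. ennreal (\<bar>f x - a\<bar> powr p) \<partial>M)
           \<le> ennreal C * (\<integral>\<^sup>+ x. ennreal (\<bar>deriv f x\<bar> powr p) \<partial>M)
         \<longleftrightarrow> (\<forall>\<epsilon>>0. \<exists>a. (\<integral>x. \<bar>f x - a\<bar> powr p \<partial>M) \<le> C * (\<integral>x. \<bar>deriv f x\<bar> powr p \<partial>M) + \<epsilon>)"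
    (is "?L \<longleftrightarrow> ?R")
proof -
  obtain B where B: "\<And>x. \<bar>f x\<bar> \<le> B" "\<And>x. \<bar>deriv f x\<bar> \<le> B" using test_function_bounded[OF f] by metis
  note m = test_function_measurable[OF f]
  define F where "F a = (\<integral>x. \<bar>f x - a\<bar> powr p \<partial>M)" for a
  define I where "I = (\<integral>x. \<bar>deriv f x\<bar> powr p \<partial>M)"
  have F: "(\<integral>\<^sup>+ x. ennreal (\<bar>f x - a\<bar> powr p) \<partial>M) = ennreal (F a)" for a
    unfolding F_def
  proof (rule nn_integral_eq_integral)
    show "integrable M (\<lambda>x. \<bar>f x - a\<bar> powr p)"
    proof (rule integrable_powr_bounded)
      show "\<bar>f x - a\<bar> \<le> B + \<bar>a\<bar>" for x using B(1)[of x] by linarith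
    qed (use m p in auto)
  qed simp
  have I: "(\<integral>\<^sup>+ x. ennreal (\<bar>deriv f x\<bar> powr p) \<partial>M) = ennreal I"
    unfolding I_def by (rule nn_integral_eq_integral[OF integrable_powr_bounded[OF m(2) B(2) p]]) simp
  have pos: "0 \<le> F a" "0 \<le> I" for a unfolding F_def I_def by auto
  have "?L \<longleftrightarrow> (INF a. ennreal (F a)) \<le> ennreal (C * I)"
    unfolding F I using C pos by (simp add: ennreal_mult)
  also have "\<dots> \<longleftrightarrow> (\<forall>\<epsilon>>0. \<exists>a. F a \<le> C * I + \<epsilon>)"
  proof (intro iffI allI impI)
    fix \<epsilon> :: real assume "(INF a. ennreal (F a)) \<le> ennreal (C * I)" "\<epsilon> > 0"
    moreover have "ennreal (C * I) < ennreal (C * I + \<epsilon>)"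
      using C pos \<open>\<epsilon> > 0\<close> by (intro ennreal_lessI) (auto intro!: add_nonneg_pos)
    ultimately have "(INF a. ennreal (F a)) < ennreal (C * I + \<epsilon>)" by (meson le_less_trans)
    then obtain a where "ennreal (F a) < ennreal (C * I + \<epsilon>)" by (auto simp: INF_less_iff)
    then show "\<exists>a. F a \<le> C * I + \<epsilon>" using pos by (intro exI[of _ a]) (simp add: ennreal_less_iff)
  next
    assume *: "\<forall>\<epsilon>>0. \<exists>a. F a \<le> C * I + \<epsilon>"
    show "(INF a. ennreal (F a)) \<le> ennreal (C * I)"
    proof (rule ennreal_le_epsilon)
      fix e :: real assume "e > 0"
      then obtain a where "F a \<le> C * I + e" using * by blast
      then have "ennreal (F a) \<le> ennreal (C * I) + ennreal e"
        using C pos \<open>e > 0\<close> by (simp flip: ennreal_plus)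
      then show "(INF a. ennreal (F a)) \<le> ennreal (C * I) + ennreal e"
        by (rule INF_lower2[OF UNIV_I])
    qed
  qed
  finally show ?thesis by (simp add: F_def I_def)
qed

lemma (in real_distribution) poincare_Lp_const_le:
  assumes "p \<ge> 0" "C \<ge> 0" "Lp_admissible p M C"
  shows "poincare_Lp_const p M \<le> ennreal C"
  unfolding poincare_Lp_const_def
proof (rule Inf_lower, rule CollectI, rule ballI)
  fix f assume f: "f \<in> test_functions"
  then show "(INF a::real. \<integral>\<^sup>+ x. ennreal (\<bar>f x - a\<bar> powr p) \<partial>M)
           \<le> ennreal C * (\<integral>\<^sup>+ x. ennreal (\<bar>deriv f x\<bar> powr p) \<partial>M)"
    using assms(3) ennreal_Poincare_iff[OF assms(1,2) f] unfolding Lp_admissible_def by blast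
qed

text \<open>Strictness provides a competing constant below C, whether or not the infimum is
  attained.\<close>

lemma (in real_distribution) Lp_admissible_if_const_less:
  assumes "p \<ge> 0" "C \<ge> 0" "poincare_Lp_const p M < ennreal C"
  shows "Lp_admissible p M C"
  unfolding Lp_admissible_def
proof
  fix f assume f: "f \<in> test_functions"
  obtain c where c: "c < ennreal C" "\<And>f. f \<in> test_functions \<Longrightarrow> (INF a::real. \<integral>\<^sup>+ x. ennreal (\<bar>f x - a\<bar> powr p) \<partial>M)
           \<le> c * (\<integral>\<^sup>+ x. ennreal (\<bar>deriv f x\<bar> powr p) \<partial>M)"
    using assms(3) unfolding poincare_Lp_const_def Inf_less_iff by blast
  have "(INF a::real. \<integral>\<^sup>+ x. ennreal (\<bar>f x - a\<bar> powr p) \<partial>M)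
           \<le> ennreal C * (\<integral>\<^sup>+ x. ennreal (\<bar>deriv f x\<bar> powr p) \<partial>M)"
    using c(1) by (intro order_trans[OF c(2)[OF f] mult_right_mono]) auto
  then show "\<forall>\<epsilon>>0. \<exists>a. (\<integral>x. \<bar>f x - a\<bar> powr p \<partial>M) \<le> C * (\<integral>x. \<bar>deriv f x\<bar> powr p \<partial>M) + \<epsilon>"
    unfolding ennreal_Poincare_iff[OF assms(1,2) f] .
qed

text \<open>The mean m minimises the quadratic deviation: expanding around m, the cross term
  integrates to 0 and (m - a)^2 remains.\<close>

lemma (in real_distribution) poincare_const_eq: "poincare_const M = poincare_Lp_const 2 M"
proof -
  have "(INF a::real. \<integral>\<^sup>+ x. ennreal (\<bar>f x - a\<bar> powr 2) \<partial>M)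
      = (\<integral>\<^sup>+ x. ennreal (\<bar>f x - (\<integral>y. f y \<partial>M)\<bar>\<^sup>2) \<partial>M)" (is "?I = ?m") if f: "f \<in> test_functions" for f
  proof (rule antisym)
    obtain B where B: "\<And>x. \<bar>f x\<bar> \<le> B" using test_function_bounded[OF f] by metis
    have [measurable]: "f \<in> borel_measurable borel" by (rule test_function_measurable[OF f])
    have int: "integrable M f" by (rule integrable_const_bound[of _ B]) (use B in auto)
    have int2: "integrable M (\<lambda>x. (f x - c)\<^sup>2)" for c
    proof (rule integrable_const_bound[of _ "(B + \<bar>c\<bar>)\<^sup>2"])
      have "\<bar>f x - c\<bar> \<le> B + \<bar>c\<bar>" for x using B[of x] by linarith
      then have "\<bar>(f x - c)\<^sup>2\<bar> \<le> (B + \<bar>c\<bar>)\<^sup>2" for x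
        using power_mono[of "\<bar>f x - c\<bar>" "B + \<bar>c\<bar>" 2] by simp
      then show "AE x in M. norm ((f x - c)\<^sup>2) \<le> (B + \<bar>c\<bar>)\<^sup>2" by simp
    qed simp
    define m where "m = (\<integral>y. f y \<partial>M)"
    show "?I \<le> ?m" by (rule INF_lower2[of m]) (simp_all add: m_def powr_realpow[symmetric])
    show "?m \<le> ?I"
    proof (rule INF_greatest)
      fix a :: real
      have "(\<integral>x. (f x - a)\<^sup>2 \<partial>M) = (\<integral>x. (f x - m)\<^sup>2 + (2 * (m - a)) * (f x - m) + (m - a)\<^sup>2 \<partial>M)"
        by (intro Bochner_Integration.integral_cong) (auto simp: power2_eq_square algebra_simps)
      also have "\<dots> = (\<integral>x. (f x - m)\<^sup>2 \<partial>M) + (2 * (m - a)) * ((\<integral>x. f x \<partial>M) - m) + (m - a)\<^sup>2"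
        using int int2 prob_space by simp
      finally have "(\<integral>x. (f x - m)\<^sup>2 \<partial>M) \<le> (\<integral>x. (f x - a)\<^sup>2 \<partial>M)" by (simp add: m_def)
      then have "(\<integral>\<^sup>+ x. ennreal ((f x - m)\<^sup>2) \<partial>M) \<le> (\<integral>\<^sup>+ x. ennreal ((f x - a)\<^sup>2) \<partial>M)"
        using int2 by (simp add: nn_integral_eq_integral ennreal_leI)
      then show "?m \<le> (\<integral>\<^sup>+ x. ennreal (\<bar>f x - a\<bar> powr 2) \<partial>M)" by (simp add: m_def)
    qed
  qed
  then show ?thesis unfolding poincare_const_def poincare_Lp_const_def by simp
qed

section \<open>Measures as monotone images of the uniform distribution\<close>

abbreviation image_of_uniform :: "(real \<Rightarrow> real) \<Rightarrow> real measure" where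
  "image_of_uniform Q \<equiv> distr (restrict_space lborel {0<..<1}) borel Q"

lemma prob_space_uniform: "prob_space (restrict_space lborel {0<..<1::real})"
  by (auto simp: space_restrict_space emeasure_restrict_space intro!: prob_spaceI)

lemma measurable_uniform_mono:
  fixes Q :: "real \<Rightarrow> real"
  assumes "mono_on {0<..<1} Q"
  shows "Q \<in> borel_measurable (restrict_space lborel {0<..<1})"
  using borel_measurable_mono_on_fnc[OF assms]
  by (simp add: measurable_def space_restrict_space sets_restrict_space)

lemma real_distribution_image_of_uniform:
  assumes "mono_on {0<..<1} Q"
  shows "real_distribution (image_of_uniform Q)"
  using prob_space.prob_space_distr[OF prob_space_uniform measurable_uniform_mono[OF assms]]
  by (simp add: real_distribution_def real_distribution_axioms_def)

lemma real_distribution_eq_image_of_uniform: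
  assumes "real_distribution \<mu>"
  shows "image_of_uniform (quantile \<mu>) = \<mu>" "mono_on {0<..<1} (quantile \<mu>)"
proof -
  interpret cdf_distribution \<mu> using assms by (simp add: cdf_distribution_def)
  show "image_of_uniform (quantile \<mu>) = \<mu>" using distr_I_eq_M by (simp add: quantile_def[abs_def])
  show "mono_on {0<..<1} (quantile \<mu>)" using mono_I by (simp add: quantile_def[abs_def])
qed

lemma ennreal_powr_mono: "0 \<le> a \<Longrightarrow> x \<le> y \<Longrightarrow> ennreal_powr x a \<le> ennreal_powr y a"
  unfolding ennreal_powr_def
  by (auto simp: top_unique less_top enn2real_mono intro!: ennreal_leI powr_mono2)

lemma mono_on_combination:
  fixes Q0 Q1 :: "real \<Rightarrow> real"
  assumes "mono_on S Q0" "mono_on S Q1" "0 \<le> t" "t \<le> 1"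
  shows "mono_on S (\<lambda>u. (1 - t) * Q0 u + t * Q1 u)"
  using assms by (auto simp: mono_on_def intro!: add_mono mult_left_mono)

text \<open>Formulated for arbitrary nondecreasing functions on (0, 1) rather than for quantile
  functions, so that it applies between any two times of the interpolation and thus gives convexity,
  not only the comparison with the endpoints.\<close>

lemma poincare_Lp_const_interpolation:
  assumes mono: "mono_on {0<..<1} Q0" "mono_on {0<..<1} Q1" and t: "0 < t" "t < 1" and p: "p \<ge> 1"
  shows "ennreal_powr (poincare_Lp_const p (image_of_uniform (\<lambda>u. (1 - t) * Q0 u + t * Q1 u))) (1 / p)
    \<le> ennreal (1 - t) * ennreal_powr (poincare_Lp_const p (image_of_uniform Q0)) (1 / p)
      + ennreal t * ennreal_powr (poincare_Lp_const p (image_of_uniform Q1)) (1 / p)"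
    (is "?l \<le> ?r")
proof -
  define Q where "Q u = (1 - t) * Q0 u + t * Q1 u" for u
  have Q: "mono_on {0<..<1} Q" unfolding Q_def by (rule mono_on_combination) (use mono t in auto)
  have "{0<..<1::real} \<noteq> {}" by simp
  then obtain T0 T1 where T: "mono T0" "mono T1" "\<And>x. (1 - t) * T0 x + t * T1 x = x"
    and TQ: "\<And>u. u \<in> {0<..<1} \<Longrightarrow> T0 (Q u) = Q0 u" "\<And>u. u \<in> {0<..<1} \<Longrightarrow> T1 (Q u) = Q1 u"
    using monotone_splitting[OF mono _ t Q_def] by metis
  interpret M: real_distribution "image_of_uniform Q" by (rule real_distribution_image_of_uniform[OF Q])
  have push: "distr (image_of_uniform Q) borel T = image_of_uniform R"
    if "mono T" "\<And>u. u \<in> {0<..<1} \<Longrightarrow> T (Q u) = R u" for T R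
    using that(2)
    by (subst distr_distr[OF borel_measurable_mono[OF that(1)] measurable_uniform_mono[OF Q]])
      (auto intro!: distr_cong simp: space_restrict_space)
  have push0: "distr (image_of_uniform Q) borel T0 = image_of_uniform Q0" by (rule push[OF T(1) TQ(1)])
  have push1: "distr (image_of_uniform Q) borel T1 = image_of_uniform Q1" by (rule push[OF T(2) TQ(2)])
  define c0 where "c0 = poincare_Lp_const p (image_of_uniform Q0)"
  define c1 where "c1 = poincare_Lp_const p (image_of_uniform Q1)"
  show ?thesis
  proof (cases "c0 = \<infinity> \<or> c1 = \<infinity>")
    case True
    then have "?r = \<infinity>" using t unfolding c0_def[symmetric] c1_def[symmetric]
      by (auto simp: ennreal_powr_def ennreal_mult_eq_top_iff ennreal_top_mult)
    then show ?thesis by (metis infinity_ennreal_def top_greatest)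
  next
    case False
    then obtain r0 r1 where r: "c0 = ennreal r0" "c1 = ennreal r1" "0 \<le> r0" "0 \<le> r1"
      by (metis ennreal_cases infinity_ennreal_def)
    define k0 where "k0 = r0 powr (1 / p)"
    define k1 where "k1 = r1 powr (1 / p)"
    have k: "0 \<le> k0" "0 \<le> k1" "k0 powr p = r0" "k1 powr p = r1"
      using r p by (auto simp: k0_def k1_def powr_powr)
    have r_eq: "?r = ennreal ((1 - t) * k0 + t * k1)"
      using r k t unfolding c0_def[symmetric] c1_def[symmetric]
      by (simp add: ennreal_powr_def k0_def k1_def ennreal_mult)
    show ?thesis unfolding r_eq
    proof (rule ennreal_le_epsilon)
      fix e :: real assume e: "e > 0"
      \<comment> \<open>Two levels are needed above each constant: k + e / 2 is positive and
        strictly above it, hence admissible, and k + e leaves the gap that the pullback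
        consumes.\<close>
      have less: "r0 < (k0 + e / 2) powr p" "r1 < (k1 + e / 2) powr p"
        unfolding k(3,4)[symmetric] using k(1,2) e p by (auto intro!: powr_less_mono2)
      have "Lp_admissible p (image_of_uniform Q0) ((k0 + e / 2) powr p)"
        by (intro real_distribution.Lp_admissible_if_const_less real_distribution_image_of_uniform mono)
          (use p r less in \<open>auto simp: c0_def[symmetric] ennreal_less_iff\<close>)
      moreover have "Lp_admissible p (image_of_uniform Q1) ((k1 + e / 2) powr p)"
        by (intro real_distribution.Lp_admissible_if_const_less real_distribution_image_of_uniform mono)
          (use p r less in \<open>auto simp: c1_def[symmetric] ennreal_less_iff\<close>)
      ultimately have "Lp_admissible p (image_of_uniform Q) (((1 - t) * (k0 + e) + t * (k1 + e)) powr p)"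
        using k(1,2) e
        by (intro M.Lp_admissible_combination[OF T t p, of "k0 + e / 2" "k0 + e" "k1 + e / 2" "k1 + e",
              unfolded push0 push1]) auto
      also have "(1 - t) * (k0 + e) + t * (k1 + e) = ((1 - t) * k0 + t * k1) + e"
        by (simp add: algebra_simps)
      finally have "poincare_Lp_const p (image_of_uniform Q) \<le> ennreal ((((1 - t) * k0 + t * k1) + e) powr p)"
        by (intro M.poincare_Lp_const_le) (use p in auto)
      then have "ennreal_powr (poincare_Lp_const p (image_of_uniform Q)) (1 / p)
          \<le> ennreal_powr (ennreal ((((1 - t) * k0 + t * k1) + e) powr p)) (1 / p)"
        using p by (intro ennreal_powr_mono) auto
      also have "\<dots> = ennreal ((1 - t) * k0 + t * k1 + e)"
        using k(1,2) t p e by (simp add: ennreal_powr_def powr_powr)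
      also have "\<dots> = ennreal ((1 - t) * k0 + t * k1) + ennreal e"
        using k(1,2) t e by (intro ennreal_plus) auto
      finally show "?l \<le> ennreal ((1 - t) * k0 + t * k1) + ennreal e" unfolding Q_def .
    qed
  qed
qed

section \<open>The Cheeger constant\<close>

lemma open_open_nbhd: "open (open_nbhd A r)"
proof -
  have "open {x. infdist x A < r}" by (intro open_Collect_less continuous_intros)
  then show ?thesis by (simp add: open_nbhd_def)
qed

lemma open_nbhd_superset: "0 < r \<Longrightarrow> A \<subseteq> open_nbhd A r"
  by (auto simp: open_nbhd_def)

text \<open>With u and v the masses of the sets where a function equals 1 and 0, the right side is a
  lower bound for its L^1 distance to the constant a.\<close>

lemma min_add_le: "\<lbrakk>0 \<le> (u::real); 0 \<le> v\<rbrakk> \<Longrightarrow> min u v \<le> u * \<bar>1 - a\<bar> + v * \<bar>a\<bar>"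
proof -
  assume uv: "0 \<le> u" "0 \<le> v"
  have "min u v * 1 \<le> min u v * (\<bar>1 - a\<bar> + \<bar>a\<bar>)" using uv by (intro mult_left_mono) auto
  also have "\<dots> \<le> u * \<bar>1 - a\<bar> + v * \<bar>a\<bar>"
    unfolding distrib_left using uv by (intro add_mono mult_right_mono) auto
  finally show ?thesis by simp
qed

lemma abs_clamp_diff_le: "\<bar>max 0 (min 1 u) - max 0 (min 1 v)\<bar> \<le> \<bar>u - v\<bar>" for u v :: real
  by linarith

text \<open>The inequality is tested on a C^1 approximation of the indicator of A. The term 1 / R is
  the slope of the cutoff at infinity, 1 / (r - 2 * \<delta>) that of the descent around A.\<close>

lemma (in real_distribution) isoperimetry_approx:
  assumes adm: "Lp_admissible 1 M C" and C: "C > 0" and A: "A \<in> sets borel"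
    and \<delta>: "0 < \<delta>" "2 * \<delta> < r" and R: "R \<ge> 1" and \<epsilon>: "\<epsilon> > 0"
  shows "min (measure M (A \<inter> {-R..R - \<delta>})) (1 - measure M (open_nbhd A r))
    \<le> C * (1 / R + (measure M (open_nbhd A r) - measure M A) / (r - 2 * \<delta>)) + \<epsilon>"
proof -
  \<comment> \<open>Equal to 1 up to distance \<delta> from A and to 0 from distance r - \<delta>
    on. The two margins absorb the shift by \<delta> in the averaging that follows.\<close>
  define gA where "gA x = max 0 (min 1 ((r - \<delta> - infdist x A) / (r - 2 * \<delta>)))" for x
  define gR where "gR x = max 0 (min 1 (2 - \<bar>x\<bar> / R))" for x :: real
  define g where "g x = gA x * gR x" for x
  have gA_cont: "continuous_on UNIV gA" unfolding gA_def using \<delta> by (intro continuous_intros) auto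
  have gR_cont: "continuous_on UNIV gR" unfolding gR_def using R by (intro continuous_intros) auto
  have g_cont: "continuous_on UNIV g" unfolding g_def by (intro continuous_intros gA_cont gR_cont)
  have bnd: "0 \<le> gA x" "gA x \<le> 1" "0 \<le> gR x" "gR x \<le> 1" for x by (auto simp: gA_def gR_def)
  have gA1: "gA x = 1" if "infdist x A \<le> \<delta>" for x
    using that \<delta> by (simp add: gA_def le_divide_eq_1)
  have gA0: "gA x = 0" if "infdist x A \<ge> r - \<delta>" for x
  proof -
    have "(r - \<delta> - infdist x A) / (r - 2 * \<delta>) \<le> 0" using that \<delta> by (intro divide_nonpos_pos) auto
    then show ?thesis by (simp add: gA_def)
  qed
  have gR1: "gR x = 1" if "\<bar>x\<bar> \<le> R" for x
  proof -
    have "\<bar>x\<bar> / R \<le> 1" using that R by (simp add: field_simps)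
    then show ?thesis by (simp add: gR_def)
  qed
  have gR0: "gR x = 0" if "\<bar>x\<bar> \<ge> 2 * R" for x
  proof -
    have "2 \<le> \<bar>x\<bar> / R" using that R by (simp add: field_simps)
    then show ?thesis by (simp add: gR_def)
  qed
  have gA_Lip: "\<bar>gA x - gA y\<bar> \<le> \<bar>x - y\<bar> / (r - 2 * \<delta>)" for x y
  proof -
    have "\<bar>gA x - gA y\<bar> \<le> \<bar>(r - \<delta> - infdist x A) / (r - 2 * \<delta>) - (r - \<delta> - infdist y A) / (r - 2 * \<delta>)\<bar>"
      unfolding gA_def by (rule abs_clamp_diff_le)
    also have "\<dots> = \<bar>infdist x A - infdist y A\<bar> / (r - 2 * \<delta>)"
      using \<delta> by (simp add: diff_divide_distrib[symmetric] abs_minus_commute)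
    also have "\<dots> \<le> \<bar>x - y\<bar> / (r - 2 * \<delta>)"
      using \<delta> infdist_triangle_abs[of x A y] by (intro divide_right_mono) (auto simp: dist_real_def)
    finally show ?thesis .
  qed
  have gR_Lip: "\<bar>gR x - gR y\<bar> \<le> \<bar>x - y\<bar> / R" for x y
  proof -
    have "\<bar>gR x - gR y\<bar> \<le> \<bar>(2 - \<bar>x\<bar> / R) - (2 - \<bar>y\<bar> / R)\<bar>"
      unfolding gR_def by (rule abs_clamp_diff_le)
    also have "\<dots> = \<bar>\<bar>x\<bar> - \<bar>y\<bar>\<bar> / R"
      using R by (simp add: diff_divide_distrib[symmetric] abs_minus_commute)
    also have "\<dots> \<le> \<bar>x - y\<bar> / R" using R by (intro divide_right_mono) auto
    finally show ?thesis .
  qed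
  have g0: "g x = 0" if "x \<notin> {-(2*R)..2*R}" for x
  proof -
    have "\<bar>x\<bar> \<ge> 2 * R" using that unfolding atLeastAtMost_iff by linarith
    then show ?thesis by (simp add: g_def gR0)
  qed
  have gB: "\<bar>g x\<bar> \<le> 1" for x
    using bnd[of x] by (simp add: g_def abs_mult mult_le_one)
  have int: "integrable lborel g"
    by (rule integrable_bounded_support[OF borel_measurable_continuous_onI[OF g_cont] gB g0])
  \<comment> \<open>Averaging the Lipschitz function g over [x, x + \<delta>] makes it C^1, and its
    derivative is a difference quotient of g, bounded by the Lipschitz constants.\<close>
  define f where "f x = (primitive g (x + \<delta>) - primitive g x) / \<delta>" for x
  define \<phi> where "\<phi> x = (g (x + \<delta>) - g x) / \<delta>" for x
  have Dprim: "(primitive g has_real_derivative g x) (at x)" for x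
    using g_cont by (intro DERIV_from_increments primitive_increment[OF int])
      (auto simp: continuous_on_eq_continuous_at)
  have D: "(f has_real_derivative \<phi> x) (at x)" for x
    unfolding f_def \<phi>_def
    by (intro DERIV_cdivide DERIV_diff Dprim) (use DERIV_shift Dprim in blast)
  have \<phi>_cont: "continuous_on UNIV \<phi>"
    unfolding \<phi>_def using \<delta> by (intro continuous_intros continuous_on_compose2[OF g_cont]) auto
  have \<phi>0: "\<phi> x = 0" if "x \<notin> {-(2*R+\<delta>)..2*R+\<delta>}" for x
  proof -
    have "x \<notin> {-(2*R)..2*R}" "x + \<delta> \<notin> {-(2*R)..2*R}"
      using that \<delta> unfolding atLeastAtMost_iff by linarith+
    then show ?thesis by (simp add: \<phi>_def g0)
  qed
  have test: "f \<in> test_functions" "deriv f = \<phi>"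
    by (rule test_functionI[OF D \<phi>_cont \<phi>0]; assumption)+
  have infd: "infdist z A \<le> infdist x A + \<delta>" "infdist x A \<le> infdist z A + \<delta>"
    if "x \<le> z" "z \<le> x + \<delta>" for x z
    using infdist_triangle[of z A x] infdist_triangle[of x A z] that by (auto simp: dist_real_def)
  \<comment> \<open>On A, and at distance at least r from it, gA takes the same value at x and x +
    \<delta>; only gR varies there.\<close>
  have \<phi>_le: "\<bar>\<phi> x\<bar> \<le> 1 / R + indicator (open_nbhd A r - A) x * (1 / (r - 2 * \<delta>))" for x
  proof -
    have gAx: "\<bar>gA (x + \<delta>) - gA x\<bar> \<le> indicator (open_nbhd A r - A) x * (\<delta> / (r - 2 * \<delta>))"
    proof (cases "x \<in> open_nbhd A r - A")
      case True
      then show ?thesis using gA_Lip[of "x + \<delta>" x] \<delta> by simp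
    next
      case False
      then consider "x \<in> A" | "infdist x A \<ge> r" by (auto simp: open_nbhd_def)
      then have "gA (x + \<delta>) = gA x"
      proof cases
        case 1
        then show ?thesis using infd(1)[of x "x + \<delta>"] \<delta> by (simp add: gA1)
      next
        case 2
        then show ?thesis using infd(2)[of x "x + \<delta>"] \<delta> by (simp add: gA0)
      qed
      then show ?thesis using False by simp
    qed
    have "g (x + \<delta>) - g x = (gA (x + \<delta>) - gA x) * gR (x + \<delta>) + gA x * (gR (x + \<delta>) - gR x)"
      by (simp add: g_def algebra_simps)
    also have "\<bar>\<dots>\<bar> \<le> \<bar>gA (x + \<delta>) - gA x\<bar> * gR (x + \<delta>) + gA x * \<bar>gR (x + \<delta>) - gR x\<bar>"
      using bnd by (intro order_trans[OF abs_triangle_ineq]) (auto simp: abs_mult)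
    also have "\<dots> \<le> (indicator (open_nbhd A r - A) x * (\<delta> / (r - 2 * \<delta>))) * 1 + 1 * (\<delta> / R)"
      using bnd gAx gR_Lip[of "x + \<delta>" x] \<delta> by (intro add_mono mult_mono) auto
    finally have "\<bar>g (x + \<delta>) - g x\<bar> / \<delta> \<le>
        ((indicator (open_nbhd A r - A) x * (\<delta> / (r - 2 * \<delta>))) * 1 + 1 * (\<delta> / R)) / \<delta>"
      using \<delta> by (intro divide_right_mono) auto
    then show ?thesis using \<delta> by (simp add: \<phi>_def add_divide_distrib)
  qed
  have f1: "f x = 1" if x: "x \<in> A \<inter> {-R..R - \<delta>}" for x
  proof -
    have "\<bar>primitive g (x + \<delta>) - primitive g x - 1 * (x + \<delta> - x)\<bar> \<le> 0 * (x + \<delta> - x)"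
    proof (rule primitive_increment[OF int])
      fix z assume z: "x < z" "z < x + \<delta>"
      then have "gA z = 1" using infd(1)[of x z] x by (intro gA1) auto
      moreover have "gR z = 1" using z x by (intro gR1) auto
      ultimately show "\<bar>g z - 1\<bar> \<le> 0" by (simp add: g_def)
    qed (use \<delta> in simp)
    then show ?thesis using \<delta> by (simp add: f_def)
  qed
  have f0: "f x = 0" if x: "x \<notin> open_nbhd A r" for x
  proof -
    have "\<bar>primitive g (x + \<delta>) - primitive g x - 0 * (x + \<delta> - x)\<bar> \<le> 0 * (x + \<delta> - x)"
    proof (rule primitive_increment[OF int])
      fix z assume z: "x < z" "z < x + \<delta>"
      then have "gA z = 0" using infd(2)[of x z] x by (intro gA0) (auto simp: open_nbhd_def)
      then show "\<bar>g z - 0\<bar> \<le> 0" by (simp add: g_def)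
    qed (use \<delta> in simp)
    then show ?thesis by (simp add: f_def)
  qed
  have [measurable]: "open_nbhd A r \<in> sets borel" by (rule borel_open[OF open_open_nbhd])
  note [measurable] = A
  obtain a where a: "(\<integral>x. \<bar>f x - a\<bar> powr 1 \<partial>M) \<le> C * (\<integral>x. \<bar>\<phi> x\<bar> powr 1 \<partial>M) + \<epsilon>"
    using adm test \<epsilon> unfolding Lp_admissible_def by metis
  obtain B where B: "\<And>x. \<bar>f x\<bar> \<le> B" "\<And>x. \<bar>\<phi> x\<bar> \<le> B" using test_function_bounded[OF test(1)] test(2) by metis
  have [measurable]: "f \<in> borel_measurable borel" "\<phi> \<in> borel_measurable borel"
    using test_function_measurable[OF test(1)] test(2) by auto
  define A' where "A' = A \<inter> {-R..R - \<delta>}"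
  have [measurable]: "A' \<in> sets borel" by (simp add: A'_def)
  have disj: "A' \<inter> - open_nbhd A r = {}"
    using open_nbhd_superset[of r A] \<delta> by (auto simp: A'_def)
  have compl: "1 - measure M (open_nbhd A r) = measure M (- open_nbhd A r)"
    using prob_compl[of "open_nbhd A r"] by (simp add: Compl_eq_Diff_UNIV)
  have "min (measure M A') (measure M (- open_nbhd A r))
      \<le> measure M A' * \<bar>1 - a\<bar> + measure M (- open_nbhd A r) * \<bar>a\<bar>"
    by (intro min_add_le) auto
  also have "measure M A' * \<bar>1 - a\<bar> + measure M (- open_nbhd A r) * \<bar>a\<bar>
      = (\<integral>x. indicator A' x * \<bar>1 - a\<bar> + indicator (- open_nbhd A r) x * \<bar>a\<bar> \<partial>M)"
    by (subst Bochner_Integration.integral_add) (auto simp: less_top[symmetric])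
  also have "\<dots> \<le> (\<integral>x. \<bar>f x - a\<bar> powr 1 \<partial>M)"
  proof (rule integral_mono')
    show "integrable M (\<lambda>x. \<bar>f x - a\<bar> powr 1)"
    proof (rule integrable_powr_bounded)
      show "\<bar>f x - a\<bar> \<le> B + \<bar>a\<bar>" for x using B(1)[of x] by linarith
    qed auto
    fix x
    show "indicator A' x * \<bar>1 - a\<bar> + indicator (- open_nbhd A r) x * \<bar>a\<bar> \<le> \<bar>f x - a\<bar> powr 1"
      using f1[of x] f0[of x] disj by (cases "x \<in> A'"; cases "x \<in> open_nbhd A r") (auto simp: A'_def)
  qed simp
  also note a
  also have "(\<integral>x. \<bar>\<phi> x\<bar> powr 1 \<partial>M) \<le> (\<integral>x. 1 / R + indicator (open_nbhd A r - A) x * (1 / (r - 2 * \<delta>)) \<partial>M)"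
    by (rule integral_mono') (use \<phi>_le \<delta> R in \<open>auto simp: less_top[symmetric]\<close>)
  also have "\<dots> = 1 / R + measure M (open_nbhd A r - A) * (1 / (r - 2 * \<delta>))"
    using prob_space by (subst Bochner_Integration.integral_add) (auto simp: less_top[symmetric])
  also have "measure M (open_nbhd A r - A) = measure M (open_nbhd A r) - measure M A"
    using open_nbhd_superset[of r A] \<delta> by (intro finite_measure_Diff) auto
  finally show ?thesis using C unfolding A'_def compl by simp
qed

text \<open>All parameters go to the limit at once: R = 2 * Suc n, \<delta> = r / 4 * e n and
  \<epsilon> = e n. The factor r / 4 guarantees 2 * \<delta> < r.\<close>

lemma (in real_distribution) isoperimetry:
  assumes adm: "Lp_admissible 1 M C" and C: "C > 0" and A: "A \<in> sets borel" and r: "r > 0"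
  shows "min (measure M A) (1 - measure M (open_nbhd A r)) \<le> C * ((measure M (open_nbhd A r) - measure M A) / r)"
proof (rule LIMSEQ_le)
  define D where "D = measure M (open_nbhd A r) - measure M A"
  define e where "e n = inverse (real (Suc n))" for n
  have e: "e \<longlonglongrightarrow> 0" unfolding e_def by (rule LIMSEQ_inverse_real_of_nat)
  have epos: "e n > 0" "e n \<le> 1" for n unfolding e_def by (auto simp: inverse_le_1_iff)
  have [measurable]: "A \<in> sets borel" by fact
  have "(\<lambda>n. measure M (A \<inter> {-(2 * real (Suc n))..2 * real (Suc n) - r / 4 * e n})) \<longlonglongrightarrow> measure M A"
  proof (rule tendsto_sandwich[OF _ _ _ tendsto_const])
    have "(\<lambda>n. measure M (A \<inter> {- real (Suc n)..real (Suc n) - r / 4})) \<longlonglongrightarrow> measure M (\<Union>n. A \<inter> {- real (Suc n)..real (Suc n) - r / 4})"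
      by (intro finite_Lim_measure_incseq) (auto simp: incseq_def)
    also have "(\<Union>n. A \<inter> {- real (Suc n)..real (Suc n) - r / 4}) = A"
    proof (intro equalityI subsetI)
      fix x assume "x \<in> A"
      obtain n where "\<bar>x\<bar> + r / 4 < real n" using reals_Archimedean2 by blast
      then have "x \<in> {- real (Suc n)..real (Suc n) - r / 4}" using r by auto
      then show "x \<in> (\<Union>n. A \<inter> {- real (Suc n)..real (Suc n) - r / 4})" using \<open>x \<in> A\<close> by blast
    qed auto
    finally show "(\<lambda>n. measure M (A \<inter> {- real (Suc n)..real (Suc n) - r / 4})) \<longlonglongrightarrow> measure M A" .
    have "measure M (A \<inter> {- real (Suc n)..real (Suc n) - r / 4})
        \<le> measure M (A \<inter> {-(2 * real (Suc n))..2 * real (Suc n) - r / 4 * e n})" for n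
    proof (rule finite_measure_mono)
      have "r / 4 * e n \<le> r / 4 * 1" using r epos[of n] by (intro mult_left_mono) auto
      then show "A \<inter> {- real (Suc n)..real (Suc n) - r / 4} \<subseteq> A \<inter> {-(2 * real (Suc n))..2 * real (Suc n) - r / 4 * e n}"
        by auto
    qed auto
    then show "\<forall>\<^sub>F n in sequentially. measure M (A \<inter> {- real (Suc n)..real (Suc n) - r / 4})
        \<le> measure M (A \<inter> {-(2 * real (Suc n))..2 * real (Suc n) - r / 4 * e n})" by simp
    show "\<forall>\<^sub>F n in sequentially. measure M (A \<inter> {-(2 * real (Suc n))..2 * real (Suc n) - r / 4 * e n}) \<le> measure M A"
      by (auto intro!: always_eventually finite_measure_mono)
  qed
  then show "(\<lambda>n. min (measure M (A \<inter> {-(2 * real (Suc n))..2 * real (Suc n) - r / 4 * e n})) (1 - measure M (open_nbhd A r)))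
      \<longlonglongrightarrow> min (measure M A) (1 - measure M (open_nbhd A r))"
    by (intro tendsto_min tendsto_const)
  have "(\<lambda>n. C * (1 / 2 * e n + D / (r - 2 * (r / 4 * e n))) + e n) \<longlonglongrightarrow> C * (1 / 2 * 0 + D / (r - 2 * (r / 4 * 0))) + 0"
    using r by (intro tendsto_intros e) auto
  then show "(\<lambda>n. C * (1 / 2 * e n + D / (r - 2 * (r / 4 * e n))) + e n) \<longlonglongrightarrow> C * (D / r)" by simp
  show "\<exists>N. \<forall>n\<ge>N. min (measure M (A \<inter> {-(2 * real (Suc n))..2 * real (Suc n) - r / 4 * e n})) (1 - measure M (open_nbhd A r))
      \<le> C * (1 / 2 * e n + D / (r - 2 * (r / 4 * e n))) + e n"
  proof (intro exI allI impI)
    fix n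
    have "1 / 2 * e n = 1 / (2 * real (Suc n))" by (simp add: e_def inverse_eq_divide)
    moreover have "2 * (r / 4 * e n) < r" using r epos[of n] by (simp add: mult_less_cancel_left2)
    ultimately show "min (measure M (A \<inter> {-(2 * real (Suc n))..2 * real (Suc n) - r / 4 * e n})) (1 - measure M (open_nbhd A r))
      \<le> C * (1 / 2 * e n + D / (r - 2 * (r / 4 * e n))) + e n"
      unfolding D_def
      using isoperimetry_approx[OF adm C A, of "r / 4 * e n" r "2 * real (Suc n)" "e n"] r epos[of n] by simp
  qed
qed

lemma (in real_distribution) inverse_cheeger_le: "1 / cheeger_const M \<le> poincare_Lp_const 1 M"
proof (cases "poincare_Lp_const 1 M = \<infinity>")
  case False
  then obtain c where c: "poincare_Lp_const 1 M = ennreal c" "0 \<le> c"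
    by (metis ennreal_cases infinity_ennreal_def)
  show ?thesis unfolding c(1)
  proof (rule ennreal_le_epsilon)
    fix e :: real assume e: "e > 0"
    define C where "C = c + e / 2"
    have C: "C > 0" using c e by (simp add: C_def)
    have adm: "Lp_admissible 1 M C"
      by (rule Lp_admissible_if_const_less) (use c e in \<open>auto simp: C_def ennreal_less_iff\<close>)
    have "ennreal (1 / (c + e)) \<le> cheeger_const M"
      unfolding cheeger_const_def
    proof (rule INF_greatest)
      fix A assume "A \<in> {A \<in> sets borel. 0 < measure M A \<and> measure M A < 1}"
      then have A: "A \<in> sets borel" "0 < measure M A" "measure M A < 1" by auto
      define m where "m = min (measure M A) (1 - measure M A)"
      have m: "m > 0" using A by (simp add: m_def)
      have "ennreal (m / (c + e)) \<le> ennreal ((measure M (open_nbhd A r) - measure M A) / r)"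
        if r: "0 < r" "r < e / 2" for r
      proof -
        define D where "D = measure M (open_nbhd A r) - measure M A"
        have D: "0 \<le> D" unfolding D_def using open_nbhd_superset[OF r(1), of A] open_open_nbhd[of A r]
          by (simp add: finite_measure_mono)
        \<comment> \<open>Enlarging A to its neighbourhood costs at most D = r * (D / r), so the
          constant only grows from C to C + r \<le> c + e.\<close>
        have "m \<le> min (measure M A) (1 - measure M (open_nbhd A r)) + D"
          using D by (auto simp: m_def D_def)
        also have "\<dots> \<le> C * (D / r) + D"
          using isoperimetry[OF adm C A(1) r(1)] by (simp add: D_def)
        also have "\<dots> = (C + r) * (D / r)" using r by (simp add: field_simps)
        also have "\<dots> \<le> (c + e) * (D / r)"
          using r D by (intro mult_right_mono) (auto simp: C_def)
        finally have "m / (c + e) \<le> D / r"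
          using c e by (simp add: divide_le_eq mult.commute)
        then show ?thesis unfolding D_def by (rule ennreal_leI)
      qed
      then have "ennreal (m / (c + e)) \<le> boundary_measure M A"
        unfolding boundary_measure_def
        by (intro Liminf_bounded) (use e in \<open>auto simp: eventually_at_right_field intro!: exI[of _ "e / 2"]\<close>)
      then have "ennreal (m / (c + e)) / ennreal m \<le> boundary_measure M A / ennreal m"
        by (rule divide_right_mono_ennreal)
      moreover have "ennreal (m / (c + e)) / ennreal m = ennreal (1 / (c + e))"
        using m c e by (simp add: divide_ennreal)
      ultimately show "ennreal (1 / (c + e)) \<le> boundary_measure M A / ennreal (min (measure M A) (1 - measure M A))"
        by (simp add: m_def)
    qed
    then have "1 / cheeger_const M \<le> ennreal (c + e)"
    proof (cases "cheeger_const M")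
      case (real k)
      then have k: "1 / (c + e) \<le> k" "0 < 1 / (c + e)"
        using \<open>ennreal (1 / (c + e)) \<le> cheeger_const M\<close> c e by auto
      then have "0 < k" by linarith
      then have "1 / k \<le> c + e" using k(1) c e by (simp add: field_simps)
      moreover have "1 / cheeger_const M = ennreal (1 / k)"
        using divide_ennreal[of 1 k] k real by simp
      ultimately show ?thesis by (simp add: ennreal_leI)
    qed simp
    then show "1 / cheeger_const M \<le> ennreal c + ennreal e"
      using c e by simp
  qed
qed simp

section \<open>Coarea inequality: from isoperimetry to the inequality with p = 1\<close>

text \<open>Tonelli for the region between the graphs of a and b. Where b < a the layer is empty and
  \<open>ennreal\<close> truncates the difference to 0.\<close>

lemma (in real_distribution) nn_integral_layers:
  fixes a b :: "real \<Rightarrow> real"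
  assumes [measurable]: "a \<in> borel_measurable borel" "b \<in> borel_measurable borel"
  shows "(\<integral>\<^sup>+ s. emeasure M {x. a x \<le> s \<and> s < b x} \<partial>lborel) = (\<integral>\<^sup>+ x. ennreal (b x - a x) \<partial>M)"
proof -
  interpret pair_sigma_finite M lborel ..
  define I where "I x s = (if a x \<le> s \<and> s < b x then 1 else 0 :: ennreal)" for x s
  have [measurable]: "case_prod I \<in> borel_measurable (M \<Otimes>\<^sub>M lborel)" unfolding I_def by measurable
  have "emeasure M {x. a x \<le> s \<and> s < b x} = (\<integral>\<^sup>+ x. I x s \<partial>M)" for s
  proof -
    have "{x. a x \<le> s \<and> s < b x} \<in> sets M" by measurable
    then have "emeasure M {x. a x \<le> s \<and> s < b x} = (\<integral>\<^sup>+ x. indicator {x. a x \<le> s \<and> s < b x} x \<partial>M)"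
      by simp
    also have "\<dots> = (\<integral>\<^sup>+ x. I x s \<partial>M)" by (intro nn_integral_cong) (auto simp: I_def indicator_def)
    finally show ?thesis .
  qed
  then have "(\<integral>\<^sup>+ s. emeasure M {x. a x \<le> s \<and> s < b x} \<partial>lborel) = (\<integral>\<^sup>+ s. (\<integral>\<^sup>+ x. I x s \<partial>M) \<partial>lborel)"
    by simp
  also have "\<dots> = (\<integral>\<^sup>+ x. (\<integral>\<^sup>+ s. I x s \<partial>lborel) \<partial>M)" by (rule Fubini') measurable
  also have "\<dots> = (\<integral>\<^sup>+ x. ennreal (b x - a x) \<partial>M)"
  proof (intro nn_integral_cong)
    fix x
    have "(\<integral>\<^sup>+ s. I x s \<partial>lborel) = (\<integral>\<^sup>+ s. indicator {a x..<b x} s \<partial>lborel)"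
      by (intro nn_integral_cong) (auto simp: I_def indicator_def)
    also have "\<dots> = ennreal (b x - a x)" by (cases "a x \<le> b x") (auto simp: ennreal_neg)
    finally show "(\<integral>\<^sup>+ s. I x s \<partial>lborel) = ennreal (b x - a x)" .
  qed
  finally show ?thesis .
qed

text \<open>With \<open>a\<close> a median of \<open>f\<close>, this is the layer cake formula for \<open>\<integral>\<bar>f - a\<bar>\<close>.\<close>

lemma (in real_distribution) median_layers:
  fixes f :: "real \<Rightarrow> real"
  assumes [measurable]: "f \<in> borel_measurable borel" and B: "\<And>x. \<bar>f x\<bar> \<le> B"
  shows "\<exists>a. (\<integral>\<^sup>+ x. ennreal \<bar>f x - a\<bar> \<partial>M)
    \<le> (\<integral>\<^sup>+ s. ennreal (min (measure M {x. s < f x}) (1 - measure M {x. s < f x})) \<partial>lborel)"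
proof -
  define G where "G s = measure M {x. s < f x}" for s
  have fm: "{x. s < f x} \<in> events" for s by measurable
  have G_anti: "G t \<le> G s" if "s \<le> t" for s t
    unfolding G_def using that fm by (intro finite_measure_mono) auto
  \<comment> \<open>Above a one has G s \<le> 1/2, so the minimum is the upper tail G s; below a it
    is the lower tail 1 - G s. The level s = a is Lebesgue null.\<close>
  define a where "a = Inf {s. G s \<le> 1/2}"
  have "{x. B < f x} = {}" using B by (auto simp: abs_le_iff not_less)
  then have "G B \<le> 1/2" by (simp add: G_def)
  then have ne: "{s. G s \<le> 1/2} \<noteq> {}" by auto
  have lower: "- B - 1 \<le> s" if "G s \<le> 1/2" for s
  proof (rule ccontr)
    assume *: "\<not> - B - 1 \<le> s"
    have "s < f x" for x using B[of x] * by linarith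
    then have "{x. s < f x} = space M" by auto
    then have "G s = 1" unfolding G_def using prob_space by simp
    then show False using that by simp
  qed
  have bdd: "bdd_below {s. G s \<le> 1/2}" using lower by (intro bdd_belowI[of _ "- B - 1"]) auto
  have above: "G s \<le> 1/2" if s: "a < s" for s
  proof -
    obtain t where "G t \<le> 1/2" "t < s" using s unfolding a_def cInf_less_iff[OF ne bdd] by auto
    then show ?thesis using G_anti[of t s] by simp
  qed
  have below: "G s > 1/2" if "s < a" for s
  proof (rule ccontr)
    assume "\<not> 1/2 < G s"
    then have "a \<le> s" unfolding a_def by (intro cInf_lower bdd) auto
    then show False using that by simp
  qed
  have compl: "measure M {x. f x \<le> s} = 1 - G s" for s
    using prob_compl[OF fm[of s]] by (simp add: G_def Compl_eq_Diff_UNIV[symmetric] Collect_neg_eq[symmetric] not_less)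
  have "(\<integral>\<^sup>+ x. ennreal \<bar>f x - a\<bar> \<partial>M) = (\<integral>\<^sup>+ x. ennreal (f x - a) + ennreal (a - f x) \<partial>M)"
    by (intro nn_integral_cong) (auto simp: abs_if ennreal_neg)
  also have "\<dots> = (\<integral>\<^sup>+ s. emeasure M {x. a \<le> s \<and> s < f x} \<partial>lborel) + (\<integral>\<^sup>+ s. emeasure M {x. f x \<le> s \<and> s < a} \<partial>lborel)"
    by (subst nn_integral_add) (auto simp: nn_integral_layers)
  also have "\<dots> = (\<integral>\<^sup>+ s. emeasure M {x. a \<le> s \<and> s < f x} + emeasure M {x. f x \<le> s \<and> s < a} \<partial>lborel)"
  proof (rule nn_integral_add[symmetric])
    have m: "(\<lambda>s. emeasure M {x. u x \<le> s \<and> s < v x}) \<in> borel_measurable lborel"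
      if [measurable]: "u \<in> borel_measurable borel" "v \<in> borel_measurable borel" for u v :: "real \<Rightarrow> real"
    proof -
      have "(\<lambda>s. emeasure M {x \<in> space M. u x \<le> s \<and> s < v x}) \<in> borel_measurable lborel"
        by measurable
      then show ?thesis by simp
    qed
    show "(\<lambda>s. emeasure M {x. a \<le> s \<and> s < f x}) \<in> borel_measurable lborel"
      "(\<lambda>s. emeasure M {x. f x \<le> s \<and> s < a}) \<in> borel_measurable lborel"
      by (rule m; measurable)+
  qed
  also have "\<dots> \<le> (\<integral>\<^sup>+ s. ennreal (min (G s) (1 - G s)) \<partial>lborel)"
  proof (rule nn_integral_mono_AE)
    have "AE s in lborel. s \<noteq> a" by (rule AE_lborel_singleton)
    then show "AE s in lborel. emeasure M {x. a \<le> s \<and> s < f x} + emeasure M {x. f x \<le> s \<and> s < a}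
        \<le> ennreal (min (G s) (1 - G s))"
    proof eventually_elim
      case (elim s)
      show ?case
      proof (cases "a < s")
        case True
        then show ?thesis using above[OF True] by (simp add: emeasure_eq_measure G_def)
      next
        case False
        then have "s < a" using elim by simp
        then show ?thesis using below[of s] by (simp add: emeasure_eq_measure compl)
      qed
    qed
  qed
  finally show ?thesis unfolding G_def by blast
qed

lemma test_function_deriv_uniformly_continuous:
  assumes f: "f \<in> test_functions" and e: "e > 0"
  obtains d where "d > 0" "\<And>x y. \<bar>x - y\<bar> < d \<Longrightarrow> \<bar>deriv f x - deriv f y\<bar> < e"
proof -
  obtain L where L: "L > 0" "\<And>x. x \<notin> {-L..L} \<Longrightarrow> deriv f x = 0" "continuous_on UNIV (deriv f)"
    using test_functionE[OF f] by metis
  have "uniformly_continuous_on {-(L+1)..L+1} (deriv f)"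
    by (intro compact_uniformly_continuous continuous_on_subset[OF L(3)]) auto
  then obtain d where d: "d > 0" "\<And>x y. x \<in> {-(L+1)..L+1} \<Longrightarrow> y \<in> {-(L+1)..L+1} \<Longrightarrow> dist y x < d
      \<Longrightarrow> dist (deriv f y) (deriv f x) < e"
    by (rule uniformly_continuous_onE[OF _ e]) blast
  show ?thesis
  proof (rule that[of "min d 1"])
    fix x y :: real assume xy: "\<bar>x - y\<bar> < min d 1"
    show "\<bar>deriv f x - deriv f y\<bar> < e"
    proof (cases "x \<in> {-(L+1)..L+1} \<and> y \<in> {-(L+1)..L+1}")
      case True
      then show ?thesis using d(2)[of y x] xy by (simp add: dist_real_def)
    next
      case False
      then have "L + 1 < \<bar>x\<bar> \<or> L + 1 < \<bar>y\<bar>" unfolding atLeastAtMost_iff by linarith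
      then have "L < \<bar>x\<bar>" "L < \<bar>y\<bar>" using xy by linarith+
      then have "x \<notin> {-L..L}" "y \<notin> {-L..L}" unfolding atLeastAtMost_iff by linarith+
      then show ?thesis using L(2) e by simp
    qed
  qed (use d in simp)
qed

text \<open>Following a sequence can only raise a lower limit. A sequence is what Fatou's lemma
  \<open>nn_integral_liminf\<close> takes.\<close>

lemma boundary_measure_le_liminf:
  assumes "filterlim r (at_right 0) sequentially"
  shows "boundary_measure \<mu> A \<le> liminf (\<lambda>n. ennreal ((measure \<mu> (open_nbhd A (r n)) - measure \<mu> A) / r n))"
  unfolding boundary_measure_def le_Liminf_iff
proof (intro allI impI)
  fix y assume "y < Liminf (at_right 0) (\<lambda>r. ennreal ((measure \<mu> (open_nbhd A r) - measure \<mu> A) / r))"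
  then have "\<forall>\<^sub>F r in at_right 0. y < ennreal ((measure \<mu> (open_nbhd A r) - measure \<mu> A) / r)"
    by (rule less_LiminfD)
  then show "\<forall>\<^sub>F n in sequentially. y < ennreal ((measure \<mu> (open_nbhd A (r n)) - measure \<mu> A) / r n)"
    by (rule eventually_compose_filterlim[OF _ assms])
qed

lemma cheeger_const_mult_le:
  assumes "A \<in> sets borel" "0 < measure \<mu> A" "measure \<mu> A < 1"
  shows "cheeger_const \<mu> * ennreal (min (measure \<mu> A) (1 - measure \<mu> A)) \<le> boundary_measure \<mu> A"
proof -
  let ?m = "ennreal (min (measure \<mu> A) (1 - measure \<mu> A))"
  have "cheeger_const \<mu> \<le> boundary_measure \<mu> A / ?m"
    unfolding cheeger_const_def using assms by (intro INF_lower) auto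
  then have "cheeger_const \<mu> * ?m \<le> boundary_measure \<mu> A / ?m * ?m" by (rule mult_right_mono) simp
  also have "\<dots> = boundary_measure \<mu> A"
    using assms by (simp add: ennreal_divide_times)
  finally show ?thesis .
qed

text \<open>A point x within distance r of {f > s} but outside it satisfies f x \<le> s < f x + r *
  (|f' x| + \<omega>). This bounds the boundary quotient at level s by a layer; integrating over s
  gives the integral of |f'| + \<omega>, and Fatou's lemma lets \<omega> tend to 0.\<close>

lemma (in real_distribution) cheeger_coarea:
  assumes f: "f \<in> test_functions"
  shows "cheeger_const M * (INF a::real. \<integral>\<^sup>+ x. ennreal \<bar>f x - a\<bar> \<partial>M) \<le> (\<integral>\<^sup>+ x. ennreal \<bar>deriv f x\<bar> \<partial>M)"
proof -
  obtain B where B: "\<And>x. \<bar>f x\<bar> \<le> B" "\<And>x. \<bar>deriv f x\<bar> \<le> B" using test_function_bounded[OF f] by metis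
  have [measurable]: "f \<in> borel_measurable borel" "deriv f \<in> borel_measurable borel"
    by (rule test_function_measurable[OF f])+
  have D: "\<And>x. (f has_real_derivative deriv f x) (at x)" using test_functionE[OF f] by metis
  define \<omega> where "\<omega> n = inverse (real (Suc n))" for n
  have \<omega>: "\<omega> n > 0" for n by (simp add: \<omega>_def)
  have \<omega>_lim: "\<omega> \<longlonglongrightarrow> 0" unfolding \<omega>_def by (rule LIMSEQ_inverse_real_of_nat)
  have "\<exists>d>0. \<forall>x y. \<bar>x - y\<bar> < d \<longrightarrow> \<bar>deriv f x - deriv f y\<bar> < \<omega> n" for n
    using test_function_deriv_uniformly_continuous[OF f \<omega>[of n]] by metis
  then obtain d where d: "\<And>n. d n > 0" "\<And>n x y. \<bar>x - y\<bar> < d n \<Longrightarrow> \<bar>deriv f x - deriv f y\<bar> < \<omega> n"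
    by metis
  \<comment> \<open>\<open>d n\<close> keeps the oscillation of f' below \<open>\<omega> n\<close>
    on balls of radius \<open>r n\<close>; \<open>\<omega> n\<close> forces the radii to 0.\<close>
  define r where "r n = min (d n) (\<omega> n)" for n
  have r: "r n > 0" "r n \<le> \<omega> n" for n using d(1) \<omega> by (auto simp: r_def)
  have r_lim: "filterlim r (at_right 0) sequentially"
  proof (rule tendsto_imp_filterlim_at_right)
    show "r \<longlonglongrightarrow> 0"
      by (rule tendsto_sandwich[OF _ _ tendsto_const \<omega>_lim]) (auto intro!: always_eventually less_imp_le[OF r(1)] r(2))
  qed (use r in simp)
  define F where "F n x = f x + r n * (\<bar>deriv f x\<bar> + \<omega> n)" for n x
  have [measurable]: "F n \<in> borel_measurable borel" for n unfolding F_def by measurable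
  have F: "f y \<le> F n x" if "\<bar>x - y\<bar> < r n" for n x y
  proof -
    have "norm (f y - f x) \<le> (\<bar>deriv f x\<bar> + \<omega> n) * norm (y - x)"
    proof (rule field_differentiable_bound[of "{z. \<bar>z - x\<bar> < r n}"])
      have "{z. \<bar>z - x\<bar> < r n} = ball x (r n)" by (auto simp: dist_real_def)
      then show "convex {z. \<bar>z - x\<bar> < r n}" by simp
      fix z assume "z \<in> {z. \<bar>z - x\<bar> < r n}"
      then have "\<bar>deriv f z - deriv f x\<bar> < \<omega> n" by (intro d(2)) (simp add: r_def)
      then show "norm (deriv f z) \<le> \<bar>deriv f x\<bar> + \<omega> n" by simp
      show "(f has_real_derivative deriv f z) (at z within {z. \<bar>z - x\<bar> < r n})"
        by (rule has_field_derivative_at_within[OF D])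
    qed (use that r in \<open>auto simp: abs_minus_commute\<close>)
    also have "\<dots> \<le> (\<bar>deriv f x\<bar> + \<omega> n) * r n"
      using that \<omega>[of n] by (intro mult_left_mono) (auto simp: abs_minus_commute)
    finally show ?thesis by (simp add: F_def mult.commute)
  qed
  define G where "G s = measure M {x. s < f x}" for s
  define b where "b n s = emeasure M {x. f x \<le> s \<and> s < F n x} / ennreal (r n)" for n s
  have bm [measurable]: "b n \<in> borel_measurable lborel" for n
  proof -
    have "(\<lambda>s. emeasure M {x \<in> space M. f x \<le> s \<and> s < F n x}) \<in> borel_measurable lborel" by measurable
    then show ?thesis unfolding b_def by simp
  qed
  have key: "cheeger_const M * ennreal (min (G s) (1 - G s)) \<le> liminf (\<lambda>n. b n s)" for s
  proof (cases "0 < G s \<and> G s < 1")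
    case False
    \<comment> \<open>At these levels the left side is 0 even for an infinite Cheeger constant,
      because \<infinity> * 0 = 0.\<close>
    then have "min (G s) (1 - G s) = 0"
      using measure_nonneg[of M "{x. s < f x}"] prob_le_1[of "{x. s < f x}"] by (auto simp: G_def min_def)
    then show ?thesis by simp
  next
    case True
    define A where "A = {x. s < f x}"
    have A: "A \<in> sets borel" unfolding A_def by measurable
    have "A \<noteq> {}"
    proof
      assume "A = {}"
      then have "G s = 0" by (simp add: G_def A_def[symmetric])
      then show False using True by simp
    qed
    have "ennreal ((measure M (open_nbhd A (r n)) - measure M A) / r n) \<le> b n s" for n
    proof -
      have "open_nbhd A (r n) \<subseteq> A \<union> {x. f x \<le> s \<and> s < F n x}"
      proof
        fix x assume "x \<in> open_nbhd A (r n)"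
        then obtain y where "y \<in> A" "dist x y < r n"
          using \<open>A \<noteq> {}\<close> by (auto simp: open_nbhd_def infdist_def cInf_less_iff)
        then show "x \<in> A \<union> {x. f x \<le> s \<and> s < F n x}"
          using F[of x y n] by (auto simp: A_def dist_real_def)
      qed
      then have "measure M (open_nbhd A (r n)) \<le> measure M (A \<union> {x. f x \<le> s \<and> s < F n x})"
        using A by (intro finite_measure_mono) auto
      also have "\<dots> \<le> measure M A + measure M {x. f x \<le> s \<and> s < F n x}"
        using A by (intro measure_Un_le) auto
      finally have "(measure M (open_nbhd A (r n)) - measure M A) / r n \<le> measure M {x. f x \<le> s \<and> s < F n x} / r n"
        using r(1)[of n] by (intro divide_right_mono) auto
      then show ?thesis
        unfolding b_def emeasure_eq_measure using r(1)[of n] by (simp add: divide_ennreal ennreal_leI)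
    qed
    then have "liminf (\<lambda>n. ennreal ((measure M (open_nbhd A (r n)) - measure M A) / r n)) \<le> liminf (\<lambda>n. b n s)"
      by (intro Liminf_mono) simp
    then show ?thesis
      using cheeger_const_mult_le[OF A, of M] boundary_measure_le_liminf[OF r_lim, of M A] True
      by (force simp: G_def A_def)
  qed
  define I where "I = (\<integral>\<^sup>+ x. ennreal \<bar>deriv f x\<bar> \<partial>M)"
  have intb: "(\<integral>\<^sup>+ s. b n s \<partial>lborel) = I + ennreal (\<omega> n)" for n
  proof -
    have "(\<integral>\<^sup>+ s. b n s \<partial>lborel) = (\<integral>\<^sup>+ s. emeasure M {x. f x \<le> s \<and> s < F n x} \<partial>lborel) / ennreal (r n)"
      unfolding b_def
    proof (rule nn_integral_divide)
      have "(\<lambda>s. emeasure M {x \<in> space M. f x \<le> s \<and> s < F n x}) \<in> borel_measurable lborel" by measurable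
      then show "(\<lambda>s. emeasure M {x. f x \<le> s \<and> s < F n x}) \<in> borel_measurable lborel" by simp
    qed
    also have "\<dots> = (\<integral>\<^sup>+ x. ennreal (r n) * ennreal (\<bar>deriv f x\<bar> + \<omega> n) \<partial>M) / ennreal (r n)"
      using r(1)[of n] \<omega>[of n] by (subst nn_integral_layers) (auto simp: F_def ennreal_mult)
    also have "\<dots> = (\<integral>\<^sup>+ x. ennreal (\<bar>deriv f x\<bar> + \<omega> n) \<partial>M)"
      using r(1)[of n] by (subst nn_integral_cmult) (simp_all add: mult_divide_eq_ennreal mult.commute[of "ennreal (r n)"])
    also have "\<dots> = (\<integral>\<^sup>+ x. ennreal \<bar>deriv f x\<bar> + ennreal (\<omega> n) \<partial>M)"
      using \<omega>[of n] by (intro nn_integral_cong) (simp add: less_imp_le)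
    also have "\<dots> = I + ennreal (\<omega> n)"
      using emeasure_space_1 by (subst nn_integral_add) (auto simp: I_def)
    finally show ?thesis .
  qed
  have "(\<lambda>n. I + ennreal (\<omega> n)) \<longlonglongrightarrow> I + ennreal 0"
    by (intro tendsto_add tendsto_const tendsto_ennrealI \<omega>_lim)
  then have lim: "liminf (\<lambda>n. \<integral>\<^sup>+ s. b n s \<partial>lborel) = I"
    unfolding intb by (auto intro: lim_imp_Liminf)
  have Gm: "(\<lambda>s. ennreal (min (G s) (1 - G s))) \<in> borel_measurable lborel"
  proof -
    have "(\<lambda>s. measure M {x \<in> space M. s < f x}) \<in> borel_measurable lborel" by measurable
    then have "G \<in> borel_measurable lborel" by (simp add: G_def[abs_def])
    then show ?thesis by measurable
  qed
  obtain a where a: "(\<integral>\<^sup>+ x. ennreal \<bar>f x - a\<bar> \<partial>M) \<le> (\<integral>\<^sup>+ s. ennreal (min (G s) (1 - G s)) \<partial>lborel)"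
    using median_layers[of f, OF test_function_measurable(1)[OF f] B(1)] unfolding G_def by blast
  have "(INF a::real. \<integral>\<^sup>+ x. ennreal \<bar>f x - a\<bar> \<partial>M) \<le> (\<integral>\<^sup>+ s. ennreal (min (G s) (1 - G s)) \<partial>lborel)"
    by (rule INF_lower2[of a]) (simp_all add: a)
  then have "cheeger_const M * (INF a::real. \<integral>\<^sup>+ x. ennreal \<bar>f x - a\<bar> \<partial>M)
      \<le> cheeger_const M * (\<integral>\<^sup>+ s. ennreal (min (G s) (1 - G s)) \<partial>lborel)"
    by (rule mult_left_mono) simp
  also have "\<dots> = (\<integral>\<^sup>+ s. cheeger_const M * ennreal (min (G s) (1 - G s)) \<partial>lborel)"
    using Gm by (simp add: nn_integral_cmult)
  also have "\<dots> \<le> (\<integral>\<^sup>+ s. liminf (\<lambda>n. b n s) \<partial>lborel)" by (intro nn_integral_mono key)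
  also have "\<dots> \<le> liminf (\<lambda>n. \<integral>\<^sup>+ s. b n s \<partial>lborel)" by (rule nn_integral_liminf) measurable
  finally show ?thesis unfolding lim I_def .
qed

lemma (in real_distribution) inverse_cheeger_eq: "1 / cheeger_const M = poincare_Lp_const 1 M"
proof (rule antisym[OF inverse_cheeger_le])
  show "poincare_Lp_const 1 M \<le> 1 / cheeger_const M"
  proof (cases "cheeger_const M = 0")
    case h0: False
    show ?thesis
      unfolding poincare_Lp_const_def
    proof (rule Inf_lower, rule CollectI, rule ballI)
      fix f assume f: "f \<in> test_functions"
      define X where "X = (INF a::real. \<integral>\<^sup>+ x. ennreal \<bar>f x - a\<bar> \<partial>M)"
      define Y where "Y = (\<integral>\<^sup>+ x. ennreal \<bar>deriv f x\<bar> \<partial>M)"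
      obtain B where B: "\<And>x. \<bar>deriv f x\<bar> \<le> B" using test_function_bounded[OF f] by metis
      have "Y \<le> (\<integral>\<^sup>+ x. ennreal B \<partial>M)" unfolding Y_def by (intro nn_integral_mono ennreal_leI B)
      then have Y: "Y < \<infinity>" using emeasure_space_1 by (auto intro: le_less_trans)
      have XY: "cheeger_const M * X \<le> Y" unfolding X_def Y_def by (rule cheeger_coarea[OF f])
      have "X \<le> 1 / cheeger_const M * Y"
      proof (cases "cheeger_const M = \<infinity>")
        case True
        \<comment> \<open>Since f' is bounded, Y is finite, and \<infinity> * X \<le> Y forces X =
          0.\<close>
        then have "X = 0" using XY Y by (auto simp: ennreal_top_mult split: if_splits)
        then show ?thesis by simp
      next
        case False
        then have "X = 1 / cheeger_const M * (cheeger_const M * X)"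
          using h0 by (simp add: mult.assoc[symmetric] ennreal_divide_times less_top)
        also have "\<dots> \<le> 1 / cheeger_const M * Y" by (intro mult_left_mono XY) simp
        finally show ?thesis .
      qed
      then show "(INF a::real. \<integral>\<^sup>+ x. ennreal (\<bar>f x - a\<bar> powr 1) \<partial>M)
          \<le> 1 / cheeger_const M * (\<integral>\<^sup>+ x. ennreal (\<bar>deriv f x\<bar> powr 1) \<partial>M)"
        by (simp add: X_def Y_def)
    qed
  qed simp
qed

lemma ennreal_powr_inverse_one: "ennreal_powr x (1 / 1) = x"
  by (cases x) (auto simp: ennreal_powr_def)

theorem theorem4p1:
  fixes \<mu>0 \<mu>1 :: "real measure"
  assumes "real_distribution \<mu>0" and "real_distribution \<mu>1"
  defines "\<mu> \<equiv> monotone_interpolation \<mu>0 \<mu>1"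
  shows "(\<forall>p\<ge>1.
            ennreal_convex_on {0..1} (\<lambda>t. ennreal_powr (poincare_Lp_const p (\<mu> t)) (1 / p)) \<and>
            (\<forall>t\<in>{0<..<1}.
               ennreal_powr (poincare_Lp_const p (\<mu> t)) (1 / p)
                 \<le> ennreal (1 - t) * ennreal_powr (poincare_Lp_const p \<mu>0) (1 / p)
                   + ennreal t * ennreal_powr (poincare_Lp_const p \<mu>1) (1 / p))) \<and>
         (\<forall>t\<in>{0<..<1}.
            ennreal_powr (poincare_const (\<mu> t)) (1 / 2)
              \<le> ennreal (1 - t) * ennreal_powr (poincare_const \<mu>0) (1 / 2)
                + ennreal t * ennreal_powr (poincare_const \<mu>1) (1 / 2)) \<and>
         (\<forall>t\<in>{0<..<1}.
            1 / cheeger_const (\<mu> t)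
              \<le> ennreal (1 - t) / cheeger_const \<mu>0 + ennreal t / cheeger_const \<mu>1)"
proof -
  define Q where "Q t u = (1 - t) * quantile \<mu>0 u + t * quantile \<mu>1 u" for t u
  have \<mu>: "\<mu> t = image_of_uniform (Q t)" for t
    by (simp add: \<mu>_def monotone_interpolation_def Q_def[abs_def])
  note q0 = real_distribution_eq_image_of_uniform[OF assms(1)]
  note q1 = real_distribution_eq_image_of_uniform[OF assms(2)]
  have Q: "mono_on {0<..<1} (Q t)" if "t \<in> {0..1}" for t
    unfolding Q_def using that by (intro mono_on_combination q0 q1) auto
  have \<mu>_dist: "real_distribution (\<mu> t)" if "t \<in> {0..1}" for t
    unfolding \<mu> by (rule real_distribution_image_of_uniform[OF Q[OF that]])
  have ends: "ennreal_powr (poincare_Lp_const p (\<mu> t)) (1 / p)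
      \<le> ennreal (1 - t) * ennreal_powr (poincare_Lp_const p \<mu>0) (1 / p)
        + ennreal t * ennreal_powr (poincare_Lp_const p \<mu>1) (1 / p)"
    if "p \<ge> 1" "t \<in> {0<..<1}" for p t
    using poincare_Lp_const_interpolation[OF q0(2) q1(2) _ _ that(1), of t] that(2)
    unfolding q0(1) q1(1) \<mu> Q_def by simp
  have convex: "ennreal_convex_on {0..1} (\<lambda>t. ennreal_powr (poincare_Lp_const p (\<mu> t)) (1 / p))"
    if p: "p \<ge> 1" for p
    unfolding ennreal_convex_on_def
  proof (intro conjI ballI allI impI)
    fix x y u v :: real
    assume xy: "x \<in> {0..1}" "y \<in> {0..1}" and uv: "0 \<le> u" "0 \<le> v" "u + v = 1"
    let ?F = "\<lambda>t. ennreal_powr (poincare_Lp_const p (\<mu> t)) (1 / p)"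
    have u: "u = 1 - v" using uv by simp
    consider "v = 0" | "v = 1" | "0 < v" "v < 1" using uv by linarith
    then show "?F (u *\<^sub>R x + v *\<^sub>R y) \<le> ennreal u * ?F x + ennreal v * ?F y"
    proof cases
      case 3
      \<comment> \<open>\<open>Q\<close> is affine in time, so the segment from \<open>Q x\<close>
        to \<open>Q y\<close> is again a piece of the same interpolation.\<close>
      have "Q (u *\<^sub>R x + v *\<^sub>R y) = (\<lambda>w. (1 - v) * Q x w + v * Q y w)"
        by (auto simp: Q_def u algebra_simps)
      then show ?thesis
        using poincare_Lp_const_interpolation[OF Q[OF xy(1)] Q[OF xy(2)] 3 p] by (simp add: \<mu> u)
    qed (simp_all add: u)
  qed simp
  have variance: "ennreal_powr (poincare_const (\<mu> t)) (1 / 2)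
      \<le> ennreal (1 - t) * ennreal_powr (poincare_const \<mu>0) (1 / 2)
        + ennreal t * ennreal_powr (poincare_const \<mu>1) (1 / 2)" if t: "t \<in> {0<..<1}" for t
    using ends[of 2 t] t real_distribution.poincare_const_eq[OF assms(1)]
      real_distribution.poincare_const_eq[OF assms(2)] real_distribution.poincare_const_eq[OF \<mu>_dist[of t]]
    by simp
  have cheeger: "1 / cheeger_const (\<mu> t)
      \<le> ennreal (1 - t) / cheeger_const \<mu>0 + ennreal t / cheeger_const \<mu>1" if t: "t \<in> {0<..<1}" for t
  proof -
    have "ennreal c / cheeger_const \<nu> = ennreal c * poincare_Lp_const 1 \<nu>" if "real_distribution \<nu>" for c \<nu>
      using real_distribution.inverse_cheeger_eq[OF that] by (metis ennreal_times_divide mult.right_neutral)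
    moreover have "1 / cheeger_const (\<mu> t) = poincare_Lp_const 1 (\<mu> t)"
      using t by (intro real_distribution.inverse_cheeger_eq \<mu>_dist) auto
    ultimately show ?thesis
      using ends[of 1 t, unfolded ennreal_powr_inverse_one] t assms(1,2) by simp
  qed
  show ?thesis using ends convex variance cheeger by blast
qed

end
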